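(* Let $d\ge 1$ and let $\phi:[0,\pi]\to\mathbb{R}$ be a function with expansion $\phi(d(x,y))=\sum_{n\ge0}a_nC_n(xy)$, where $a_n>0$ for all $n\ge 0$ and $\sum_{n\ge0}d_na_n<\infty$. Let $N$ be a fixed positive integer and let $Y\subset\mathcal{S}^d$ be a finite set of points with fill-distance $h(Y,\mathcal{S}^d)\le 1/(2N)$. Let $\Lambda$ be the pseudodifferential operator on $\mathcal{S}^d$ with symbol $\lambda_n=(n(d+n-2))^s$, $n\ge0$, for some $s>0$, and suppose that $$\sum_{n\ge0}d_n\lambda_n^2a_n<\infty.$$ Let $E$ be a constant, independent of $n$, such that $\|\Lambda p\|_{L_\infty(\mathcal{S}^d)}\le E\lambda_n\|p\|_{L_\infty(\mathcal{S}^d)}$ for all $n\ge 0$ and all $p\in P_n$. Let $f\in\mathcal{H}_{\Lambda\phi}$ (so in particular $f\in\mathcal{H}_\phi$) and let $S_\phi^Y$ be the $\phi$-spline interpolant to $f$ on $Y$. Then, for all $x\in\mathcal{S}^d$, $$|f(x)-S_\phi^Y(x)|\le (1+2E)\Bigl(\sum_{n>N}d_n\lambda_n^2a_n\Bigr)^{1/2}\Bigl(\sum_{n>N}d_na_n\Bigr)^{1/2}\|f\|_{\Lambda\phi}.$$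
   Context: $\mathcal{S}^d=\{x\in\mathbb{R}^{d+1}:|x|=1\}$; $xy$ denotes the Euclidean inner product of $x,y\in\mathbb{R}^{d+1}$; $d(x,y)=\cos^{-1}(xy)$ is the geodesic distance; $\nu$ is the normalised rotationally invariant measure on $\mathcal{S}^d$ (total mass 1), and $L_2(\mathcal{S}^d)$ is taken with respect to $\nu$. The fill-distance of a finite set $Y\subset\mathcal{S}^d$ is $h(Y,\mathcal{S}^d)=\sup_{x\in\mathcal{S}^d}\min_{y\in Y}d(x,y)$. $P_n$ is the space of polynomials of degree at most $n$ on $\mathbb{R}^{d+1}$ restricted to $\mathcal{S}^d$. $H_n=P_n\cap P_{n-1}^\perp$ (orthogonal complement in $L_2(\mathcal{S}^d)$, with $P_{-1}=\{0\}$) is the space of spherical harmonics of degree $n$, $d_n=\dim H_n$, and $Y_1^n,\dots,Y_{d_n}^n$ is an orthonormal basis of $H_n$, so $L_2(\mathcal{S}^d)=\bigoplus_{n\ge0}H_n$. $T_n$ is the orthogonal projector of $L_2(\mathcal{S}^d)$ onto $H_n$. $C_n$ is the Gegenbauer polynomial of degree $n$ normalised so that $C_n(xy)=\sum_{j=1}^{d_n}Y_j^n(x)Y_j^n(y)$; thus $C_n(xy)$ is the kernel of $T_n$. The native space is $\mathcal{H}_\phi=\{f\in L_2(\mathcal{S}^d):\|f\|_\phi:=(\sum_{n\ge0}a_n^{-1}\|T_nf\|_{L_2(\mathcal{S}^d)}^2)^{1/2}<\infty\}$; its elements are identified with their continuous representatives. The $\phi$-spline interpolant to $f$ on $Y$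 is the function $S_\phi^Y(x)=\sum_{y\in Y}\alpha_y\phi(d(x,y))$ with coefficients $\alpha_y\in\mathbb{R}$ determined by $S_\phi^Y(y)=f(y)$ for all $y\in Y$. A pseudodifferential operator $\Lambda$ on $\mathcal{S}^d$ with symbol $\{\lambda_n\}_{n\ge0}$ acts by $\Lambda p_n=\lambda_np_n$ for $p_n\in H_n$, i.e. $\Lambda f=\sum_{n\ge0}\lambda_nT_nf$. The existence of a constant $E$ as in the claim is taken from the literature (a Bernstein-type inequality). $\mathcal{H}_{\Lambda\phi}=\{f\in\mathcal{H}_\phi:\|f\|_{\Lambda\phi}:=(\sum_{n\ge0}(\lambda_na_n)^{-2}\|T_nf\|_{L_2(\mathcal{S}^d)}^2)^{1/2}<\infty\}$. Where $\lambda_n=0$ (in particular for $n=0$) the weight $(\lambda_na_n)^{-2}$ is understood as $+\infty$ with $\infty\cdot0=0$, so that membership in $\mathcal{H}_{\Lambda\phi}$ requires $T_nf=0$ for such $n$. *)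

theory Defs
  imports
    "HOL-Probability.Probability"
    "HOL-Computational_Algebra.Polynomial"
    "HOL-Library.Function_Algebras"
begin

text \<open>
  The sphere of dimension \<open>d\<close> is \<open>sphere 0 1 :: (real ^ 'n) set\<close> with \<open>CARD('n) = d + 1\<close>.
\<close>

definition geodist :: "real ^ 'n \<Rightarrow> real ^ 'n \<Rightarrow> real"
  where "geodist x y = arccos (x \<bullet> y)"

text \<open>
  For nonempty finite \<open>Y\<close> the infimum is a minimum. Values are taken in \<open>ereal\<close> so that the empty
  set has fill-distance \<open>\<infinity>\<close>.
\<close>

definition fill_distance :: "(real ^ 'n) set \<Rightarrow> ereal"
  where "fill_distance Y = (SUP x\<in>sphere 0 1. INF y\<in>Y. ereal (geodist x y))"

definition normalised_invariant_measure :: "(real ^ 'n) measure \<Rightarrow> bool"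
  where "normalised_invariant_measure \<nu> \<longleftrightarrow>
    prob_space \<nu> \<and> space \<nu> = sphere 0 1 \<and>
    sets \<nu> = sets (restrict_space borel (sphere 0 1)) \<and>
    (\<forall>T. orthogonal_transformation T \<longrightarrow> distr \<nu> \<nu> T = \<nu>)"


section \<open>Square-integrable functions and spherical harmonics\<close>

definition L2_functions :: "(real ^ 'n) measure \<Rightarrow> (real ^ 'n \<Rightarrow> real) set"
  where "L2_functions \<nu> = {f. f \<in> borel_measurable \<nu> \<and> integrable \<nu> (\<lambda>x. (f x)\<^sup>2)}"

definition L2_inner :: "(real ^ 'n) measure \<Rightarrow> (real ^ 'n \<Rightarrow> real) \<Rightarrow> (real ^ 'n \<Rightarrow> real) \<Rightarrow> real"
  where "L2_inner \<nu> f g = (LINT x|\<nu>. f x * g x)"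

definition L2_nrm :: "(real ^ 'n) measure \<Rightarrow> (real ^ 'n \<Rightarrow> real) \<Rightarrow> real"
  where "L2_nrm \<nu> f = sqrt (LINT x|\<nu>. (f x)\<^sup>2)"

definition Linf_nrm :: "(real ^ 'n) measure \<Rightarrow> (real ^ 'n \<Rightarrow> real) \<Rightarrow> ereal"
  where "Linf_nrm \<nu> f = esssup \<nu> (\<lambda>x. ereal \<bar>f x\<bar>)"

text \<open>
  A function on the sphere that belongs to a space of polynomials is represented by its extension
  by zero to the whole space. This makes the spaces below genuine linear subspaces of the space of
  all functions, isomorphic to the corresponding spaces of functions on the sphere.
\<close>

definition sphere_polys :: "nat \<Rightarrow> (real ^ 'n \<Rightarrow> real) set"
  where "sphere_polys n = {p. \<exists>c :: ('n \<Rightarrow> nat) \<Rightarrow> real. \<forall>x.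
    p x = (if x \<in> sphere 0 1
           then \<Sum>\<alpha> | (\<Sum>i\<in>UNIV. \<alpha> i) \<le> n. c \<alpha> * (\<Prod>i\<in>UNIV. (x $ i) ^ \<alpha> i)
           else 0)}"

definition harmonics :: "(real ^ 'n) measure \<Rightarrow> nat \<Rightarrow> (real ^ 'n \<Rightarrow> real) set"
  where "harmonics \<nu> n =
    {p \<in> sphere_polys n. \<forall>q \<in> (case n of 0 \<Rightarrow> {\<lambda>x. 0} | Suc m \<Rightarrow> sphere_polys m).
       L2_inner \<nu> p q = 0}"

definition harm_dim :: "(real ^ 'n) measure \<Rightarrow> nat \<Rightarrow> nat"
  where "harm_dim \<nu> n = vector_space.dim (\<lambda>c f x. c * f x) (harmonics \<nu> n)"

definition orthonormal_basis_of ::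
    "(real ^ 'n) measure \<Rightarrow> (real ^ 'n \<Rightarrow> real) set \<Rightarrow> nat \<Rightarrow> (nat \<Rightarrow> real ^ 'n \<Rightarrow> real) \<Rightarrow> bool"
  where "orthonormal_basis_of \<nu> H m B \<longleftrightarrow>
    (\<forall>j\<in>{1..m}. B j \<in> H) \<and>
    (\<forall>i\<in>{1..m}. \<forall>j\<in>{1..m}. L2_inner \<nu> (B i) (B j) = (if i = j then 1 else 0)) \<and>
    (\<forall>p\<in>H. \<exists>c :: nat \<Rightarrow> real. \<forall>x. p x = (\<Sum>j=1..m. c j * B j x))"

text \<open>The orthogonal projector \<open>T\<^sub>n\<close> onto the spherical harmonics of degree \<open>n\<close>.\<close>

definition harm_proj :: "(real ^ 'n) measure \<Rightarrow> nat \<Rightarrow> (real ^ 'n \<Rightarrow> real) \<Rightarrow> (real ^ 'n \<Rightarrow> real)"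
  where "harm_proj \<nu> n f =
    (THE g. g \<in> harmonics \<nu> n \<and> (\<forall>q\<in>harmonics \<nu> n. L2_inner \<nu> (\<lambda>x. f x - g x) q = 0))"

text \<open>
  The series terminates at every point when \<open>f\<close> is a polynomial, the only case in which the
  operator itself (rather than its symbol) is applied below.
\<close>

definition pseudodiff ::
    "(real ^ 'n) measure \<Rightarrow> (nat \<Rightarrow> real) \<Rightarrow> (real ^ 'n \<Rightarrow> real) \<Rightarrow> (real ^ 'n \<Rightarrow> real)"
  where "pseudodiff \<nu> lam f = (\<lambda>x. \<Sum>n. lam n * harm_proj \<nu> n f x)"


section \<open>Gegenbauer polynomials\<close>

text \<open>
  The Gegenbauer polynomial of index \<open>(d - 1) / 2\<close> scaled to take the value \<open>1\<close> at \<open>1\<close>; this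
  scaling, unlike the classical one, is also meaningful for \<open>d = 1\<close>, where it gives the Chebyshev
  polynomials. The recurrence is \<open>(n + d - 1) P\<^sub>n\<^sub>+\<^sub>1 = (2 n + d - 1) t P\<^sub>n - n P\<^sub>n\<^sub>-\<^sub>1\<close>.
\<close>

fun gegenbauer :: "nat \<Rightarrow> nat \<Rightarrow> real poly"
  where
    "gegenbauer d 0 = 1"
  | "gegenbauer d (Suc 0) = [:0, 1:]"
  | "gegenbauer d (Suc (Suc n)) =
       smult (1 / (real n + real d))
         (smult (2 * real n + real d + 1) ([:0, 1:] * gegenbauer d (Suc n))
          - smult (real n + 1) (gegenbauer d n))"

text \<open>
  \<open>C\<close> is the Gegenbauer polynomial of degree \<open>n\<close>, scaled so that \<open>C (x \<bullet> y)\<close> is the kernel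
  \<open>\<Sum>j=1..m. B j x * B j y\<close> determined by an orthonormal basis \<open>B\<close>. These conditions determine
  \<open>C\<close> uniquely.
\<close>

definition normalised_gegenbauer ::
    "nat \<Rightarrow> nat \<Rightarrow> nat \<Rightarrow> (nat \<Rightarrow> real ^ 'n \<Rightarrow> real) \<Rightarrow> real poly \<Rightarrow> bool"
  where "normalised_gegenbauer d n m B C \<longleftrightarrow>
    (\<exists>c. C = smult c (gegenbauer d n)) \<and>
    (\<forall>x\<in>sphere 0 1. \<forall>y\<in>sphere 0 1. poly C (x \<bullet> y) = (\<Sum>j=1..m. B j x * B j y))"


section \<open>Native spaces and spline interpolation\<close>

text \<open>
  In \<open>ennreal\<close> we have \<open>inverse 0 = \<infinity>\<close> and \<open>\<infinity> * 0 = 0\<close>, so vanishing \<open>lam n\<close> are treated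
  in \<open>smooth_energy\<close> as infinite weights. Elements of the spaces are the continuous representatives.
\<close>

definition native_energy ::
    "(real ^ 'n) measure \<Rightarrow> (nat \<Rightarrow> real) \<Rightarrow> (real ^ 'n \<Rightarrow> real) \<Rightarrow> ennreal"
  where "native_energy \<nu> a f =
    (\<Sum>n. inverse (ennreal (a n)) * ennreal ((L2_nrm \<nu> (harm_proj \<nu> n f))\<^sup>2))"

definition native_space ::
    "(real ^ 'n) measure \<Rightarrow> (nat \<Rightarrow> real) \<Rightarrow> (real ^ 'n \<Rightarrow> real) set"
  where "native_space \<nu> a =
    {f \<in> L2_functions \<nu>. continuous_on (sphere 0 1) f \<and> native_energy \<nu> a f < \<infinity>}"

definition smooth_energy ::
    "(real ^ 'n) measure \<Rightarrow> (nat \<Rightarrow> real) \<Rightarrow> (nat \<Rightarrow> real) \<Rightarrow> (real ^ 'n \<Rightarrow> real) \<Rightarrow> ennreal"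
  where "smooth_energy \<nu> lam a f =
    (\<Sum>n. (inverse (ennreal (lam n * a n)))\<^sup>2 * ennreal ((L2_nrm \<nu> (harm_proj \<nu> n f))\<^sup>2))"

definition smooth_nrm ::
    "(real ^ 'n) measure \<Rightarrow> (nat \<Rightarrow> real) \<Rightarrow> (nat \<Rightarrow> real) \<Rightarrow> (real ^ 'n \<Rightarrow> real) \<Rightarrow> real"
  where "smooth_nrm \<nu> lam a f = sqrt (enn2real (smooth_energy \<nu> lam a f))"

definition smooth_space ::
    "(real ^ 'n) measure \<Rightarrow> (nat \<Rightarrow> real) \<Rightarrow> (nat \<Rightarrow> real) \<Rightarrow> (real ^ 'n \<Rightarrow> real) set"
  where "smooth_space \<nu> lam a = {f \<in> native_space \<nu> a. smooth_energy \<nu> lam a f < \<infinity>}"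

definition spline_interpolant ::
    "(real \<Rightarrow> real) \<Rightarrow> (real ^ 'n) set \<Rightarrow> (real ^ 'n \<Rightarrow> real) \<Rightarrow> (real ^ 'n \<Rightarrow> real) \<Rightarrow> bool"
  where "spline_interpolant \<phi> Y f S \<longleftrightarrow>
    (\<exists>\<alpha>. \<forall>x\<in>sphere 0 1. S x = (\<Sum>y\<in>Y. \<alpha> y * \<phi> (geodist x y))) \<and> (\<forall>y\<in>Y. S y = f y)"

definition symbol :: "nat \<Rightarrow> real \<Rightarrow> nat \<Rightarrow> real"
  where "symbol d s n = (real n * (real d + real n - 2)) powr s"


section \<open>Existence of the normalised invariant measure\<close>

text \<open>The projection of the uniform measure on the unit ball to the sphere.\<close>

lemma lborel_translation: "distr lborel borel (\<lambda>x. x + c) = (lborel :: 'a::euclidean_space measure)"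
  proof -
  have "(\<lambda>x. x + c) = (+) c" by (simp add: fun_eq_iff add.commute)
  then show ?thesis using lborel_distr_plus[of c] by simp
qed

lemma distr_lborel_orthogonal:
  fixes T :: "'a::euclidean_space \<Rightarrow> 'a"
  assumes T: "orthogonal_transformation T"
  shows "distr lborel borel T = lborel"
proof -
  define M where "M = distr lborel borel T"
  have lin: "linear T" using T by (rule orthogonal_transformation_linear)
  have cont: "continuous_on UNIV T" using lin by (simp add: linear_continuous_on linear_linear)
  have mT[measurable]: "T \<in> borel_measurable borel" using cont by (rule borel_measurable_continuous_onI)
  have sM[measurable_cong]: "sets M = sets borel" by (simp add: M_def)
  have pre: "T -` ball 0 r = ball (0::'a) r" for r
    using T by (auto simp: orthogonal_transformation_norm)
  have Mball: "emeasure M (ball (0::'a) r) = emeasure lborel (ball (0::'a) r)" for r :: real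
    by (simp add: M_def emeasure_distr pre)
  have fin: "emeasure lborel (ball (0::'a) r) \<noteq> \<infinity>" for r
    using emeasure_lborel_ball_finite[of "0::'a" r] by simp
  interpret M: sigma_finite_measure M
  proof
    show "\<exists>A. countable A \<and> A \<subseteq> sets M \<and> \<Union>A = space M \<and> (\<forall>a\<in>A. emeasure M a \<noteq> \<infinity>)"
    proof (intro exI[of _ "range (\<lambda>n::nat. ball 0 (real n))"] conjI ballI)
      show "\<Union>(range (\<lambda>n::nat. ball (0::'a) (real n))) = space M"
        by (auto simp: M_def intro: reals_Archimedean2)
    qed (use fin in \<open>auto simp: sM Mball\<close>)
  qed
  have shift: "(\<integral>\<^sup>+x. g (x + c) \<partial>M) = (\<integral>\<^sup>+x. g x \<partial>M)" if [measurable]: "g \<in> borel_measurable borel" for g c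
  proof -
    obtain b where b: "T b = c" using orthogonal_transformation_surj[OF T] by (metis surjD)
    have "(\<integral>\<^sup>+x. g (x + c) \<partial>M) = (\<integral>\<^sup>+x. g (T (x + b)) \<partial>lborel)"
      by (simp add: M_def nn_integral_distr linear_add[OF lin] b)
    also have "\<dots> = (\<integral>\<^sup>+x. g (T x) \<partial>distr lborel borel (\<lambda>x. x + b))"
      by (subst nn_integral_distr) auto
    also have "\<dots> = (\<integral>\<^sup>+x. g x \<partial>M)" by (simp add: lborel_translation M_def nn_integral_distr)
    finally show ?thesis .
  qed
  have shiftL: "(\<integral>\<^sup>+x. g (x + c) \<partial>lborel) = (\<integral>\<^sup>+x. g x \<partial>lborel)" if [measurable]: "g \<in> borel_measurable borel" for g and c :: 'a
    by (subst lborel_translation[of c, symmetric], subst nn_integral_distr) auto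
  interpret P: pair_sigma_finite lborel M ..
  define B where "B = ball (0::'a) 1"
  have [measurable]: "B \<in> sets borel" by (simp add: B_def)
  have finB: "emeasure lborel B \<noteq> \<infinity>" by (simp only: B_def fin not_False_eq_True)
  have MB: "emeasure M B = emeasure lborel B" by (simp only: B_def Mball)
  have "emeasure M A = emeasure lborel A" if [measurable]: "A \<in> sets borel" for A
  proof -
    have "emeasure M A * emeasure lborel B = (\<integral>\<^sup>+x. \<integral>\<^sup>+y. indicator A x * indicator B y \<partial>lborel \<partial>M)"
      by (subst nn_integral_cmult_indicator, simp)
         (subst nn_integral_multc, simp, simp)
    also have "\<dots> = (\<integral>\<^sup>+x. \<integral>\<^sup>+y. indicator A x * indicator B (y + (- x)) \<partial>lborel \<partial>M)"
      by (rule nn_integral_cong,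
          rule shiftL[where g = "\<lambda>y. indicator A x * indicator B y" and c = "- x" for x, symmetric])
         measurable
    also have "\<dots> = (\<integral>\<^sup>+y. \<integral>\<^sup>+x. indicator A x * indicator B (y + (- x)) \<partial>M \<partial>lborel)"
      by (subst P.Fubini') auto
    also have "\<dots> = (\<integral>\<^sup>+y. \<integral>\<^sup>+x. indicator A (x + y) * indicator B (y + (- (x + y))) \<partial>M \<partial>lborel)"
      by (rule nn_integral_cong,
          rule shift[where g = "\<lambda>x. indicator A x * indicator B (y + (- x))" for y, symmetric])
         measurable
    also have "\<dots> = (\<integral>\<^sup>+y. \<integral>\<^sup>+x. indicator A (y + x) * indicator B x \<partial>M \<partial>lborel)"
      by (intro nn_integral_cong) (auto simp: indicator_def algebra_simps B_def)
    also have "\<dots> = (\<integral>\<^sup>+x. \<integral>\<^sup>+y. indicator A (y + x) * indicator B x \<partial>lborel \<partial>M)"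
      by (subst P.Fubini') auto
    also have "\<dots> = (\<integral>\<^sup>+x. \<integral>\<^sup>+y. indicator A y * indicator B x \<partial>lborel \<partial>M)"
      by (rule nn_integral_cong,
          rule shiftL[where g = "\<lambda>y. indicator A y * indicator B x" for x])
         measurable
    also have "\<dots> = emeasure lborel A * emeasure M B"
      by (simp add: nn_integral_cmult nn_integral_multc)
    finally have eq: "emeasure M A * emeasure lborel B = emeasure lborel A * emeasure lborel B"
      by (simp only: MB)
    have "emeasure lborel B \<noteq> 0"
    proof
      assume "emeasure lborel B = 0"
      then have "measure lborel B = 0" by (simp add: measure_def)
      then show False using content_ball_pos[of 1 "0::'a"] by (simp add: B_def measure_completion)
    qed
    then show ?thesis using eq finB
      by (metis ennreal_mult_cancel_left infinity_ennreal_def mult.commute)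
  qed
  then have "M = lborel" by (intro measure_eqI) (auto simp: sM)
  then show ?thesis by (simp add: M_def)
qed

lemma normalised_invariant_measure_exists:
  "\<exists>\<nu> :: (real ^ 'n) measure. normalised_invariant_measure \<nu>"
proof -
  define U where "U = uniform_measure lborel (ball (0 :: real ^ 'n) 1)"
  define S where "S = sphere (0 :: real ^ 'n) 1"
  define e where "e = axis (undefined::'n) (1::real)"
  have eS: "e \<in> S" by (simp add: e_def S_def)
  define h where "h x = (if x = 0 then e else sgn x)" for x :: "real ^ 'n"
  have h: "h x \<in> S" for x using eS by (auto simp: h_def S_def norm_sgn)
  let ?R = "restrict_space borel S"
  have [measurable]: "sgn \<in> borel_measurable (borel :: (real ^ 'n) measure)"
    unfolding sgn_div_norm by measurable
  have hb[measurable]: "h \<in> borel_measurable borel" unfolding h_def by measurable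
  have hm[measurable]: "h \<in> measurable U ?R"
    using h by (intro measurable_restrict_space2) (auto simp: U_def)
  define \<nu> where "\<nu> = distr U ?R h"
  have fin: "emeasure lborel (ball (0 :: real ^ 'n) 1) \<noteq> \<infinity>"
    using emeasure_lborel_ball_finite[of "0::real^'n" 1] by (simp add: less_top[symmetric])
  have pos: "emeasure lborel (ball (0 :: real ^ 'n) 1) \<noteq> 0"
  proof
    assume "emeasure lborel (ball (0 :: real ^ 'n) 1) = 0"
    then have "measure lborel (ball (0 :: real ^ 'n) 1) = 0" by (simp add: measure_def)
    then show False using content_ball_pos[of 1 "0::real^'n"] by (simp add: measure_completion)
  qed
  have pU: "prob_space U" unfolding U_def using pos fin by (rule prob_space_uniform_measure)
  interpret U: prob_space U by (rule pU)
  have inv: "distr \<nu> \<nu> T = \<nu>" if T: "orthogonal_transformation T" for T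
  proof -
    have lin: "linear T" using T by (rule orthogonal_transformation_linear)
    have [measurable]: "T \<in> borel_measurable borel"
      using lin by (intro borel_measurable_continuous_onI) (simp add: linear_continuous_on linear_linear)
    have TS: "T \<in> measurable ?R ?R"
      using T by (intro measurable_restrict_space2 measurable_restrict_space1)
        (auto simp: S_def orthogonal_transformation_norm)
    have UT: "distr U borel T = U"
    proof (rule measure_eqI)
      fix A assume "A \<in> sets (distr U borel T)"
      then have A[measurable]: "A \<in> sets borel" by simp
      have "T -` (ball 0 1 \<inter> A) = ball 0 1 \<inter> T -` A"
        using T by (auto simp: orthogonal_transformation_norm)
      moreover have "emeasure (distr lborel borel T) (ball 0 1 \<inter> A) = emeasure lborel (T -` (ball 0 1 \<inter> A))"
        by (subst emeasure_distr) auto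
      ultimately have "emeasure lborel (ball 0 1 \<inter> T -` A) = emeasure lborel (ball 0 1 \<inter> A)"
        by (simp add: distr_lborel_orthogonal[OF T])
      moreover have "T -` A \<in> sets borel" using measurable_sets_borel[of T borel A] by simp
      ultimately show "emeasure (distr U borel T) A = emeasure U A"
        by (simp add: U_def emeasure_distr)
    qed (simp add: U_def)
    have "AE x in lborel. x \<noteq> (0 :: real ^ 'n)" by (rule AE_lborel_singleton)
    then have ae: "AE x in U. x \<noteq> 0"
      unfolding U_def by (intro AE_uniform_measureI) auto
    have "distr \<nu> \<nu> T = distr \<nu> ?R T" by (rule distr_cong) (simp_all add: \<nu>_def)
    also have "\<dots> = distr U ?R (T \<circ> h)" unfolding \<nu>_def using TS hm by (rule distr_distr)
    also have "\<dots> = distr U ?R (h \<circ> T)"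
    proof (rule distr_cong_AE)
      show "AE x in U. (T \<circ> h) x = (h \<circ> T) x"
        using ae
      proof eventually_elim
        case (elim x)
        then have "T x \<noteq> 0" using T by (metis norm_eq_zero orthogonal_transformation_norm)
        with elim show ?case using T
          by (simp add: h_def sgn_div_norm linear_scale[OF lin] orthogonal_transformation_norm)
      qed
      show "T \<circ> h \<in> measurable U ?R" using hm TS by (rule measurable_comp)
      have "h \<circ> T \<in> measurable borel ?R"
        using h by (intro measurable_restrict_space2) auto
      then show "h \<circ> T \<in> measurable U ?R" by (simp add: U_def cong: measurable_cong_sets)
    qed auto
    also have "\<dots> = distr (distr U borel T) ?R h"
      by (rule distr_distr[symmetric]) (use h in \<open>auto intro!: measurable_restrict_space2 simp: U_def\<close>)
    also have "\<dots> = \<nu>" by (simp add: UT \<nu>_def)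
    finally show ?thesis .
  qed
  have "prob_space \<nu>" unfolding \<nu>_def using hm by (rule U.prob_space_distr)
  then have "normalised_invariant_measure \<nu>"
    using inv by (auto simp: normalised_invariant_measure_def \<nu>_def S_def space_restrict_space)
  then show ?thesis ..
qed

end

theory Submission
  imports Defs
begin

text \<open>
  The error \<open>e = f - S\<close> vanishes on \<open>Y\<close>; split it into its frequencies up to \<open>N\<close> and its tail, and
  let \<open>h\<close> be the native norm of the tail, \<open>A\<^sup>2 = \<Sum>n>N. d\<^sub>n \<lambda>\<^sub>n\<^sup>2 a\<^sub>n\<close> and \<open>T\<^sup>2 = \<Sum>n>N. d\<^sub>n a\<^sub>n\<close>. By
  Cauchy-Schwarz the tail is at most \<open>T h\<close> everywhere. Restricted to great circles polynomials are
  trigonometric, so by M. Riesz' lemma a polynomial of degree \<open>N\<close> loses at most the factor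
  \<open>cos (1/2) \<ge> 7/8\<close> from its maximum to the nearest point of \<open>Y\<close>. The low frequencies equal minus the
  tail on \<open>Y\<close>, hence are bounded by \<open>8/7 T h\<close>, and \<open>\<bar>e\<bar> \<le> 15/7 T h\<close>.

  Measuring \<open>\<Lambda> e\<close> in \<open>L\<^sub>2\<close> rather than in the supremum norm, the low frequencies contribute at most
  \<open>\<lambda>\<^sub>N 8/7 T h \<le> 8/7 A h\<close>, and the tail at most \<open>A h / sqrt 2\<close>, because \<open>d\<^sub>n \<noteq> 1\<close> for \<open>n \<ge> 1\<close>. Since
  \<open>e\<close> is orthogonal to \<open>S\<close> in the native space, \<open>h\<^sup>2 \<le> \<langle>e, f\<rangle> \<le> \<parallel>\<Lambda> e\<parallel> \<parallel>f\<parallel>\<close>, where the last norm is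
  that of the smooth space, so \<open>h \<le> 7/5 A \<parallel>f\<parallel>\<close>. Altogether \<open>\<bar>e\<bar> \<le> 15/7 7/5 A T \<parallel>f\<parallel> = 3 A T \<parallel>f\<parallel>\<close>.
  Finally \<open>3 \<le> 1 + 2 E\<close>, as the Bernstein inequality for a spherical harmonic of degree \<open>n \<ge> 2\<close> forces
  \<open>E \<ge> 1\<close>; if there are none of degree above \<open>N\<close>, then \<open>T = 0\<close>.
\<close>


section \<open>Trigonometric polynomials\<close>

text \<open>Multiplied by e^(iNt), a real trigonometric polynomial of degree N becomes an algebraic
  polynomial of degree at most 2N in \<open>cis t\<close>. In this form its zeros within a period
  are counted as roots of \<open>Q\<close>.\<close>

definition trig_poly :: "nat \<Rightarrow> (real \<Rightarrow> real) \<Rightarrow> bool"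
  where "trig_poly N q \<longleftrightarrow>
    (\<exists>Q :: complex poly. degree Q \<le> 2 * N \<and>
       (\<forall>t. poly Q (cis t) = cis (real N * t) * complex_of_real (q t)))"

lemma trig_poly_diff:
  assumes "trig_poly N p" and "trig_poly N q"
  shows "trig_poly N (\<lambda>t. p t - q t)"
proof -
  obtain P Q where "degree P \<le> 2 * N" "degree Q \<le> 2 * N"
    and "\<And>t. poly P (cis t) = cis (real N * t) * complex_of_real (p t)"
    and "\<And>t. poly Q (cis t) = cis (real N * t) * complex_of_real (q t)"
    using assms unfolding trig_poly_def by blast
  then show ?thesis unfolding trig_poly_def
    by (intro exI[of _ "P - Q"]) (auto simp: degree_diff_le algebra_simps)
qed

lemma trig_poly_cmult:
  assumes "trig_poly N q"
  shows "trig_poly N (\<lambda>t. c * q t)"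
proof -
  obtain Q where "degree Q \<le> 2 * N"
    and "\<And>t. poly Q (cis t) = cis (real N * t) * complex_of_real (q t)"
    using assms unfolding trig_poly_def by blast
  then show ?thesis unfolding trig_poly_def
    by (intro exI[of _ "smult (complex_of_real c) Q"]) auto
qed

lemma trig_poly_cos: "trig_poly N (\<lambda>t. cos (real N * (t + \<delta>)))"
proof -
  let ?Q = "monom (cis (real N * \<delta>) / 2) (2 * N) + [:cis (- (real N * \<delta>)) / 2:]"
  have "degree ?Q \<le> 2 * N"
    by (intro degree_add_le) (auto simp: degree_monom_le)
  moreover have "poly ?Q (cis t) = cis (real N * t) * complex_of_real (cos (real N * (t + \<delta>)))" for t
  proof -
    have c: "complex_of_real (cos u) = (cis u + cis (- u)) / 2" for u
      by (simp add: complex_eq_iff)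
    show ?thesis
      by (simp add: c poly_monom Complex.DeMoivre cis_mult algebra_simps add_divide_distrib)
  qed
  ultimately show ?thesis unfolding trig_poly_def by blast
qed

lemma trig_poly_continuous:
  assumes "trig_poly N q"
  shows "continuous_on A q"
proof -
  obtain Q where Q: "\<And>t. poly Q (cis t) = cis (real N * t) * complex_of_real (q t)"
    using assms unfolding trig_poly_def by blast
  have "cis (- (real N * t)) * poly Q (cis t) = complex_of_real (q t)" for t
    by (simp add: Q mult.assoc[symmetric] cis_mult del: mult.assoc)
  then have "q t = Re (cis (- (real N * t)) * poly Q (cis t))" for t
    by simp
  then have "q = (\<lambda>t. Re (cis (- (real N * t)) * poly Q (cis t)))" by blast
  moreover have "continuous_on A (\<lambda>t. Re (cis (- (real N * t)) * poly Q (cis t)))"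
    by (intro continuous_intros)
  ultimately show ?thesis by simp
qed

lemma inj_on_cis: "inj_on cis {a..<a + 2 * pi}"
proof (rule inj_onI)
  fix u v assume u: "u \<in> {a..<a + 2 * pi}" and v: "v \<in> {a..<a + 2 * pi}" and "cis u = cis v"
  then have "cis (u - v) = 1" by (simp flip: cis_divide)
  then have "cos (u - v) = 1" by (metis cis.sel(1) one_complex.sel(1))
  then obtain n :: int where n: "u - v = of_int n * 2 * pi" by (auto simp: cos_one_2pi_int)
  have "\<bar>u - v\<bar> < 2 * pi" using u v by auto
  then have "\<bar>real_of_int n\<bar> < 1" by (simp add: n abs_mult)
  then have "n = 0" by linarith
  with n show "u = v" by simp
qed

text \<open>Distinct points of a half-open period have distinct images under \<open>cis\<close>, so
  more than 2N zeros would be more roots than the degree of a nonzero \<open>Q\<close>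
  allows.\<close>

lemma trig_poly_zeros:
  assumes "trig_poly N q" and Z: "Z \<subseteq> {a..<a + 2 * pi}" "card Z > 2 * N" "\<And>t. t \<in> Z \<Longrightarrow> q t = 0"
  shows "q t = 0"
proof -
  obtain Q where deg: "degree Q \<le> 2 * N"
    and Q: "\<And>t. poly Q (cis t) = cis (real N * t) * complex_of_real (q t)"
    using assms(1) unfolding trig_poly_def by blast
  have "Q = 0"
  proof (rule ccontr)
    assume "Q \<noteq> 0"
    have "cis ` Z \<subseteq> {z. poly Q z = 0}" using Z(3) by (auto simp: Q)
    then have "card (cis ` Z) \<le> card {z. poly Q z = 0}"
      using poly_roots_finite[OF \<open>Q \<noteq> 0\<close>] by (intro card_mono)
    also have "\<dots> \<le> 2 * N" using card_poly_roots_bound[OF \<open>Q \<noteq> 0\<close>] deg by simp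
    finally show False
      using Z(2) card_image[OF inj_on_subset[OF inj_on_cis Z(1)]] by simp
  qed
  with Q[of t] show ?thesis by simp
qed

text \<open>The intermediate value theorem gives a zero between consecutive nodes. The last node is
  left out so that nodes spanning exactly one period fit the half-open period of
  \<open>trig_poly_zeros\<close>.\<close>

lemma zeros_between_sign_changes:
  fixes q P :: "_ \<Rightarrow> real"
  assumes "continuous_on UNIV q" and "\<And>k. k < m \<Longrightarrow> P k < P (Suc k)"
    and "\<And>k. k \<le> m \<Longrightarrow> (- 1) ^ k * q (P k) > 0"
  shows "\<exists>Z. Z \<subseteq> {P 0..<P m} \<and> finite Z \<and> card Z = m \<and> (\<forall>t\<in>Z. q t = 0)"
  using assms(2,3)
proof (induction m)
  case 0
  then show ?case by (intro exI[of _ "{}"]) auto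
next
  case (Suc m)
  then obtain Z where Z: "Z \<subseteq> {P 0..<P m}" "finite Z" "card Z = m" "\<forall>t\<in>Z. q t = 0"
    by (metis less_SucI le_SucI)
  have lt: "P m < P (Suc m)" using Suc.prems(1) by simp
  have c: "continuous_on {P m..P (Suc m)} (\<lambda>t. (- 1) ^ m * q t)"
    using assms(1) continuous_on_subset by (intro continuous_intros) blast
  have "(- 1) ^ m * q (P m) > 0" "(- 1) ^ m * q (P (Suc m)) < 0"
    using Suc.prems(2)[of m] Suc.prems(2)[of "Suc m"] by auto
  then obtain z where z: "P m \<le> z" "z \<le> P (Suc m)" "(- 1) ^ m * q z = 0"
    using IVT2'[of "\<lambda>t. (- 1) ^ m * q t" "P (Suc m)" 0 "P m"] lt c by force
  then have "q z = 0" by simp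
  \<comment> \<open>The strict sign at the right node keeps the new zero inside the half-open
    interval. It differs from the earlier zeros because those lie below \<open>P m\<close>.\<close>
  have "z \<noteq> P (Suc m)" using Suc.prems(2)[of "Suc m"] \<open>q z = 0\<close> by auto
  moreover have "P 0 \<le> P j" if "j \<le> m" for j
    using that
  proof (induction j)
    case (Suc j)
    then show ?case using Suc \<open>\<And>k. k < Suc m \<Longrightarrow> P k < P (Suc k)\<close>[of j] by force
  qed simp
  then have "P 0 \<le> P m" by simp
  ultimately have "insert z Z \<subseteq> {P 0..<P (Suc m)}" "z \<notin> Z"
    using Z(1) z lt by (auto simp: subset_iff)
  then show ?case using Z \<open>q z = 0\<close>
    by (intro exI[of _ "insert z Z"]) auto
qed

text \<open>Otherwise \<open>cos (N u)\<close> minus \<open>q\<close>, which has a double zero at \<open>0\<close>, would have too many zeros in a period.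
  Shifting the cosine by \<open>\<delta>\<close> splits the double zero, and scaling \<open>q\<close> by \<open>\<rho> < 1\<close> makes all sign
  changes strict, so that only distinct zeros need to be counted.\<close>

lemma riesz_lower_bound:
  assumes q: "trig_poly N q" and bound: "\<And>t. \<bar>q t\<bar> \<le> 1" and q0: "q 0 = 1" and N: "N > 0"
    and t: "0 < t" "real N * t \<le> 1 / 2"
  shows "cos (real N * t) \<le> q t"
proof (rule ccontr)
  assume "\<not> cos (real N * t) \<le> q t"
  moreover have "0 < cos (real N * t)"
    using t N pi_gt3 by (intro cos_gt_zero) auto
  ultimately have "max (q t) 0 < cos (real N * t)" by simp
  moreover have "((\<lambda>\<delta>. cos (real N * (t + \<delta>))) \<longlongrightarrow> cos (real N * (t + 0))) (at_right 0)"
    by (intro tendsto_intros)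
  ultimately have "\<forall>\<^sub>F \<delta> in at_right 0. max (q t) 0 < cos (real N * (t + \<delta>))"
    by (intro order_tendstoD) auto
  moreover have "\<forall>\<^sub>F \<delta> in at_right 0. \<delta> < 1 / real N"
    using N by (intro order_tendstoD tendsto_intros) auto
  moreover have "\<forall>\<^sub>F \<delta> in at_right (0::real). 0 < \<delta>"
    by (rule eventually_at_right_less)
  ultimately have "\<forall>\<^sub>F \<delta> in at_right (0::real). 0 < \<delta> \<and> \<delta> < 1 / real N \<and> max (q t) 0 < cos (real N * (t + \<delta>))"
    by eventually_elim simp
  then obtain \<delta> where \<delta>: "0 < \<delta>" "\<delta> < 1 / real N" "max (q t) 0 < cos (real N * (t + \<delta>))"
    using eventually_happens'[OF trivial_limit_at_right_real] by blast
  have N\<delta>: "0 < real N * \<delta>" "real N * \<delta> < 1" using \<delta> N by (auto simp: field_simps)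
  have "cos (real N * \<delta>) < cos 0"
    using N\<delta> pi_gt3 by (intro cos_monotone_0_pi) auto
  \<comment> \<open>The lower bound on \<rho> makes the shifted cosine minus \<rho> q negative at 0;
    the upper bound keeps \<rho> q below 1 in modulus, so that the cosine decides the sign at its
    own extrema.\<close>
  then obtain \<rho> where \<rho>: "cos (real N * \<delta>) < \<rho>" "\<rho> < 1" using dense by auto
  have "0 < cos (real N * \<delta>)" using N\<delta> pi_gt3 by (intro cos_gt_zero) auto
  with \<rho> have \<rho>0: "0 < \<rho>" by simp
  define r where "r u = cos (real N * (u + \<delta>)) - \<rho> * q u" for u
  have r: "trig_poly N r" unfolding r_def
    by (intro trig_poly_diff trig_poly_cos trig_poly_cmult q)
  have small: "\<bar>\<rho> * q u\<bar> < 1" for u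
  proof -
    have "\<rho> * \<bar>q u\<bar> \<le> \<rho> * 1" using \<rho>0 bound by (intro mult_left_mono) auto
    then have "\<rho> * \<bar>q u\<bar> < 1" using \<rho>(2) by simp
    then show ?thesis using \<rho>0 by (simp add: abs_mult)
  qed
  \<comment> \<open>The nodes are -\<delta>, 0, t and the extrema j pi / N - \<delta> of the shifted
    cosine for j = 1, ..., 2N. The difference \<open>r\<close> alternates in sign along these 2N + 3
    points.\<close>
  define P where "P k = (if k = 0 then - \<delta> else if k = 1 then 0 else if k = 2 then t
    else real (k - 2) * pi / real N - \<delta>)" for k :: nat
  have "(- 1) ^ k * r (P k) > 0" if "k \<le> 2 * N + 2" for k
  proof -
    consider "k = 0" | "k = 1" | "k = 2" | "k > 2" by linarith
    then show ?thesis
    proof cases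
      case 1 then show ?thesis using small[of "- \<delta>"] by (simp add: P_def r_def)
    next
      case 2 then show ?thesis using \<rho> by (simp add: P_def r_def q0)
    next
      case 3
      \<comment> \<open>Scaling by \<rho> raises a negative \<open>q t\<close>, hence the maximum
        with 0.\<close>
      have "\<rho> * q t \<le> max (q t) 0"
        using \<rho> \<rho>0 by (cases "q t \<ge> 0") (auto simp: mult_le_0_iff mult_left_le_one_le max_def)
      then have "\<rho> * q t < cos (real N * (t + \<delta>))" using \<delta>(3) by (rule le_less_trans)
      with 3 show ?thesis by (simp add: P_def r_def)
    next
      case 4
      then obtain j where 4: "k = j + 2" "j > 0" by (metis add.commute less_imp_add_positive)
      have "cos (real j * pi) = (- 1) ^ j" by (rule cos_npi)
      moreover have "r (P k) = cos (real j * pi) - \<rho> * q (P k)"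
        using 4 N by (simp add: r_def P_def)
      ultimately have "(- 1) ^ k * r (P k) = (- 1) ^ j * (- 1) ^ j - (- 1) ^ j * (\<rho> * q (P k))"
        using 4(1) by (simp add: right_diff_distrib)
      moreover have "(- 1) ^ j * (- 1) ^ j = (1 :: real)"
        by (simp flip: power_mult_distrib)
      moreover have "\<bar>(- 1) ^ j * (\<rho> * q (P k))\<bar> < 1"
        using small[of "P k"] by (simp add: abs_mult power_abs)
      ultimately show ?thesis by linarith
    qed
  qed
  moreover have "P k < P (Suc k)" if "k < 2 * N + 2" for k
  proof -
    \<comment> \<open>This places \<open>t\<close> before the extremum pi / N - \<delta>, since N t
      + N \<delta> < 3/2 < pi.\<close>
    have "t + \<delta> < pi / real N"
    proof -
      have "real N * t + real N * \<delta> < pi" using t(2) N\<delta>(2) pi_gt3 by linarith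
      then show ?thesis using N by (simp add: field_simps)
    qed
    moreover have "real (k - 2) * pi / real N < real (Suc k - 2) * pi / real N" if "k \<ge> 2"
      using N that pi_gt_zero by (intro divide_strict_right_mono mult_strict_right_mono) linarith+
    ultimately show ?thesis using \<delta>(1) t(1) by (auto simp: P_def numeral_2_eq_2)
  qed
  ultimately obtain Z where Z: "Z \<subseteq> {P 0..<P (2 * N + 2)}" "card Z = 2 * N + 2" "\<forall>u\<in>Z. r u = 0"
    using zeros_between_sign_changes[OF trig_poly_continuous[OF r], of "2 * N + 2" P] by metis
  \<comment> \<open>The nodes span one full period, so their 2N + 2 zeros force \<open>r\<close> to
    vanish identically, although it is positive at -\<delta>.\<close>
  have "P (2 * N + 2) = P 0 + 2 * pi" using N by (simp add: P_def)
  then have "Z \<subseteq> {P 0..<P 0 + 2 * pi}" using Z(1) by (simp only:)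
  moreover have "card Z > 2 * N" using Z(2) by linarith
  ultimately have "r (- \<delta>) = 0" by (rule trig_poly_zeros[OF r]) (use Z(3) in blast)
  then show False using small[of "- \<delta>"] by (simp add: r_def)
qed


section \<open>Polynomials on the sphere\<close>

lemma trig_poly_sum:
  assumes "finite I" and "\<And>i. i \<in> I \<Longrightarrow> trig_poly N (q i)"
  shows "trig_poly N (\<lambda>t. \<Sum>i\<in>I. q i t)"
proof -
  obtain Q where "\<And>i. i \<in> I \<Longrightarrow> degree (Q i) \<le> 2 * N"
    and "\<And>i t. i \<in> I \<Longrightarrow> poly (Q i) (cis t) = cis (real N * t) * complex_of_real (q i t)"
    using assms(2) unfolding trig_poly_def by metis
  then show ?thesis unfolding trig_poly_def using assms(1)
    by (intro exI[of _ "\<Sum>i\<in>I. Q i"]) (auto intro!: degree_sum_le simp: poly_sum sum_distrib_left)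
qed

text \<open>Multiplication by \<open>cis t\<close> turns each coordinate \<open>cos t * x + sin t * v\<close> into a quadratic
  polynomial in \<open>cis t\<close>.\<close>

lemma trig_poly_great_circle_monomial:
  fixes x v :: "real ^ 'n" and \<alpha> :: "'n \<Rightarrow> nat"
  assumes "(\<Sum>i\<in>UNIV. \<alpha> i) \<le> N"
  shows "trig_poly N (\<lambda>t. \<Prod>i\<in>UNIV. ((cos t *\<^sub>R x + sin t *\<^sub>R v) $ i) ^ \<alpha> i)"
proof -
  define m where "m = (\<Sum>i\<in>UNIV. \<alpha> i)"
  define R where "R i = [:(x $ i + \<i> * v $ i) / 2, 0, (x $ i - \<i> * v $ i) / 2:]" for i
  define Q where "Q = monom 1 (N - m) * (\<Prod>i\<in>UNIV. R i ^ \<alpha> i)"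
  have "degree (\<Prod>i\<in>UNIV. R i ^ \<alpha> i) \<le> (\<Sum>i\<in>UNIV. degree (R i ^ \<alpha> i))"
    using degree_prod_sum_le[of UNIV "\<lambda>i. R i ^ \<alpha> i"] by (simp add: o_def)
  also have "\<dots> \<le> (\<Sum>i\<in>UNIV. 2 * \<alpha> i)"
  proof (rule sum_mono)
    fix i
    have "degree (R i ^ \<alpha> i) \<le> degree (R i) * \<alpha> i" by (rule degree_power_le)
    also have "\<dots> \<le> 2 * \<alpha> i" by (intro mult_right_mono) (auto simp: R_def)
    finally show "degree (R i ^ \<alpha> i) \<le> 2 * \<alpha> i" .
  qed
  finally have "degree (\<Prod>i\<in>UNIV. R i ^ \<alpha> i) \<le> 2 * m" by (simp add: m_def sum_distrib_left)
  moreover have "degree (monom (1::complex) (N - m)) \<le> N - m" by (rule degree_monom_le)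
  ultimately have "degree Q \<le> 2 * N"
    unfolding Q_def using degree_mult_le[of "monom 1 (N - m)" "\<Prod>i\<in>UNIV. R i ^ \<alpha> i"] assms m_def
    by linarith
  moreover have "poly Q (cis t) = cis (real N * t) *
      complex_of_real (\<Prod>i\<in>UNIV. ((cos t *\<^sub>R x + sin t *\<^sub>R v) $ i) ^ \<alpha> i)" for t
  proof -
    have "poly (R i) (cis t) = cis t * complex_of_real ((cos t *\<^sub>R x + sin t *\<^sub>R v) $ i)" for i
    proof -
      have "cos t * cos t * w = (1 - sin t * sin t) * w" for w
        by (simp flip: power2_eq_square add: cos_squared_eq)
      from this[of "x $ i"] this[of "v $ i"] show ?thesis
        by (simp add: R_def complex_eq_iff algebra_simps add_divide_distrib diff_divide_distrib)
    qed
    then have "poly Q (cis t) = cis t ^ (N - m) * (\<Prod>i\<in>UNIV. cis t ^ \<alpha> i) *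
        complex_of_real (\<Prod>i\<in>UNIV. ((cos t *\<^sub>R x + sin t *\<^sub>R v) $ i) ^ \<alpha> i)"
      by (simp add: Q_def poly_monom poly_prod power_mult_distrib prod.distrib mult.assoc)
    also have "cis t ^ (N - m) * (\<Prod>i\<in>UNIV. cis t ^ \<alpha> i) = cis t ^ (N - m + m)"
      by (simp add: m_def power_sum power_add)
    also have "\<dots> = cis (real N * t)" using assms by (simp add: m_def Complex.DeMoivre)
    finally show ?thesis .
  qed
  ultimately show ?thesis unfolding trig_poly_def by blast
qed

lemma unit_great_circle:
  fixes x v :: "'a::real_inner"
  assumes "norm x = 1" "norm v = 1" "x \<bullet> v = 0"
  shows "norm (cos t *\<^sub>R x + sin t *\<^sub>R v) = 1"
proof -
  have "x \<bullet> x = 1" "v \<bullet> v = 1" using assms(1,2) by (auto simp: norm_eq_1)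
  then show ?thesis using assms(3)
    by (simp add: norm_eq_1 inner_add inner_commute[of v x] power2_eq_square[symmetric])
qed

text \<open>Extending each monomial by zero turns the elements of \<open>sphere_polys\<close> into
  plain linear combinations, with no case distinction on the argument.\<close>

definition sphere_monomial :: "('n \<Rightarrow> nat) \<Rightarrow> real ^ 'n \<Rightarrow> real"
  where "sphere_monomial \<alpha> x = (if x \<in> sphere 0 1 then \<Prod>i\<in>UNIV. (x $ i) ^ \<alpha> i else 0)"

lemma sphere_polys_iff:
  fixes p :: "real ^ 'n \<Rightarrow> real"
  shows "p \<in> sphere_polys n \<longleftrightarrow>
    (\<exists>c. p = (\<lambda>x. \<Sum>\<alpha> | (\<Sum>i\<in>UNIV. \<alpha> i) \<le> n. c \<alpha> * sphere_monomial \<alpha> x))"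
proof -
  have "(if x \<in> sphere 0 1 then \<Sum>\<alpha>\<in>A. c \<alpha> * (\<Prod>i\<in>UNIV. (x $ i) ^ \<alpha> i) else 0)
      = (\<Sum>\<alpha>\<in>A. c \<alpha> * sphere_monomial \<alpha> x)" for x c and A :: "('n \<Rightarrow> nat) set"
    by (simp add: sphere_monomial_def)
  then show ?thesis unfolding sphere_polys_def mem_Collect_eq fun_eq_iff by presburger
qed

lemma finite_bounded_multi_indices: "finite {\<alpha> :: 'n::finite \<Rightarrow> nat. (\<Sum>i\<in>UNIV. \<alpha> i) \<le> n}"
proof (rule finite_subset)
  have "\<alpha> i \<le> (\<Sum>i\<in>UNIV. \<alpha> i)" for \<alpha> :: "'n \<Rightarrow> nat" and i
    by (rule member_le_sum) auto
  then show "{\<alpha> :: 'n \<Rightarrow> nat. (\<Sum>i\<in>UNIV. \<alpha> i) \<le> n} \<subseteq> PiE UNIV (\<lambda>_. {..n})"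
    unfolding PiE_UNIV_domain Pi_def by (fast intro: le_trans)
qed (rule finite_PiE; simp)

section \<open>The polynomial spaces as a filtered algebra of continuous functions\<close>

lemma sphere_polys_zero [simp]: "(\<lambda>x. 0) \<in> sphere_polys n"
  unfolding sphere_polys_iff by (intro exI[of _ "\<lambda>_. 0"]) simp

lemma sphere_polys_add:
  assumes "p \<in> sphere_polys n" "q \<in> sphere_polys n"
  shows "(\<lambda>x. p x + q x) \<in> sphere_polys n"
proof -
  obtain b c where "p = (\<lambda>x. \<Sum>\<alpha> | (\<Sum>i\<in>UNIV. \<alpha> i) \<le> n. b \<alpha> * sphere_monomial \<alpha> x)"
    "q = (\<lambda>x. \<Sum>\<alpha> | (\<Sum>i\<in>UNIV. \<alpha> i) \<le> n. c \<alpha> * sphere_monomial \<alpha> x)"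
    using assms unfolding sphere_polys_iff by blast
  then show ?thesis unfolding sphere_polys_iff
    by (intro exI[of _ "\<lambda>\<alpha>. b \<alpha> + c \<alpha>"]) (simp add: algebra_simps sum.distrib)
qed

lemma sphere_polys_cmult:
  assumes "p \<in> sphere_polys n"
  shows "(\<lambda>x. c * p x) \<in> sphere_polys n"
proof -
  obtain b where "p = (\<lambda>x. \<Sum>\<alpha> | (\<Sum>i\<in>UNIV. \<alpha> i) \<le> n. b \<alpha> * sphere_monomial \<alpha> x)"
    using assms unfolding sphere_polys_iff by blast
  then show ?thesis unfolding sphere_polys_iff
    by (intro exI[of _ "\<lambda>\<alpha>. c * b \<alpha>"]) (simp add: algebra_simps sum_distrib_left)
qed

lemma sphere_polys_sum:
  assumes "\<And>i. i \<in> I \<Longrightarrow> q i \<in> sphere_polys n"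
  shows "(\<lambda>x. \<Sum>i\<in>I. q i x) \<in> sphere_polys n"
  using assms by (induction I rule: infinite_finite_induct) (auto intro: sphere_polys_add)

lemma sphere_monomial_in_sphere_polys:
  assumes "(\<Sum>i\<in>UNIV. \<alpha> i) \<le> n"
  shows "sphere_monomial \<alpha> \<in> sphere_polys n"
proof -
  have "(\<Sum>\<beta> | (\<Sum>i\<in>UNIV. \<beta> i) \<le> n. (if \<beta> = \<alpha> then 1 else 0) * sphere_monomial \<beta> x)
      = sphere_monomial \<alpha> x" (is "?s x = _") for x
  proof -
    have "?s x = (\<Sum>\<beta> | (\<Sum>i\<in>UNIV. \<beta> i) \<le> n. if \<beta> = \<alpha> then sphere_monomial \<beta> x else 0)"
      by (rule sum.cong) auto
    also have "\<dots> = sphere_monomial \<alpha> x"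
      by (subst sum.delta[OF finite_bounded_multi_indices]) (use assms in simp)
    finally show ?thesis .
  qed
  then show ?thesis unfolding sphere_polys_iff by (intro exI ext) (rule sym)
qed

lemma sphere_polys_mono:
  assumes "p \<in> sphere_polys m" "m \<le> n"
  shows "p \<in> sphere_polys n"
proof -
  obtain c where "p = (\<lambda>x. \<Sum>\<alpha> | (\<Sum>i\<in>UNIV. \<alpha> i) \<le> m. c \<alpha> * sphere_monomial \<alpha> x)"
    using assms unfolding sphere_polys_iff by blast
  then show ?thesis using assms(2)
    by (auto intro!: sphere_polys_sum sphere_polys_cmult sphere_monomial_in_sphere_polys)
qed

lemma sphere_polys_mult:
  fixes p q :: "real ^ 'n \<Rightarrow> real"
  assumes "p \<in> sphere_polys m" "q \<in> sphere_polys n"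
  shows "(\<lambda>x. p x * q x) \<in> sphere_polys (m + n)"
proof -
  obtain b c where p: "p = (\<lambda>x. \<Sum>\<alpha> | (\<Sum>i\<in>UNIV. \<alpha> i) \<le> m. b \<alpha> * sphere_monomial \<alpha> x)"
    and q: "q = (\<lambda>x. \<Sum>\<alpha> | (\<Sum>i\<in>UNIV. \<alpha> i) \<le> n. c \<alpha> * sphere_monomial \<alpha> x)"
    using assms unfolding sphere_polys_iff by blast
  have "sphere_monomial \<alpha> x * sphere_monomial \<beta> x = sphere_monomial (\<lambda>i. \<alpha> i + \<beta> i) x"
    for \<alpha> \<beta> and x :: "real ^ 'n"
    by (simp add: sphere_monomial_def power_add prod.distrib)
  then have "(\<lambda>x. p x * q x) = (\<lambda>x. \<Sum>\<alpha> | (\<Sum>i\<in>UNIV. \<alpha> i) \<le> m. \<Sum>\<beta> | (\<Sum>i\<in>UNIV. \<beta> i) \<le> n.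
      (b \<alpha> * c \<beta>) * sphere_monomial (\<lambda>i. \<alpha> i + \<beta> i) x)"
    by (simp add: p q sum_product mult.assoc mult.left_commute fun_eq_iff)
  moreover have "\<dots> \<in> sphere_polys (m + n)"
    by (intro sphere_polys_sum sphere_polys_cmult sphere_monomial_in_sphere_polys)
       (auto simp: sum.distrib intro: add_mono)
  ultimately show ?thesis by simp
qed

lemma sphere_polys_const: "(\<lambda>x. if x \<in> sphere 0 1 then c else 0) \<in> sphere_polys n"
proof -
  have "(\<lambda>x. c * sphere_monomial (\<lambda>_. 0) x) \<in> sphere_polys n"
    by (intro sphere_polys_cmult sphere_monomial_in_sphere_polys) simp
  then show ?thesis by (simp add: sphere_monomial_def if_distrib[of "\<lambda>u. c * u"] cong: if_cong)
qed

lemma sphere_polys_coordinate: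
  fixes i :: "'n::finite"
  shows "(\<lambda>x. if x \<in> sphere 0 1 then x $ i else 0) \<in> sphere_polys 1"
proof -
  have "sphere_monomial (\<lambda>j. if j = i then 1 else 0) \<in> sphere_polys 1"
    by (intro sphere_monomial_in_sphere_polys) simp
  moreover have "(\<Prod>j\<in>UNIV. (x $ j) ^ (if j = i then 1 else 0)) = x $ i" for x :: "real ^ 'n"
    by (simp add: if_distrib[of "\<lambda>k. _ ^ k"] prod.delta cong: if_cong)
  ultimately show ?thesis unfolding sphere_monomial_def by (simp cong: if_cong)
qed

lemma sphere_polys_continuous:
  fixes p :: "real ^ 'n \<Rightarrow> real"
  assumes "p \<in> sphere_polys n"
  shows "continuous_on (sphere 0 1) p"
proof -
  obtain c where p: "p = (\<lambda>x. \<Sum>\<alpha> | (\<Sum>i\<in>UNIV. \<alpha> i) \<le> n. c \<alpha> * sphere_monomial \<alpha> x)"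
    using assms unfolding sphere_polys_iff by blast
  have "continuous_on (sphere 0 1) (\<lambda>x :: real ^ 'n. \<Prod>i\<in>UNIV. (x $ i) ^ \<alpha> i)" for \<alpha>
    by (intro continuous_intros)
  then have "continuous_on (sphere 0 1) (sphere_monomial \<alpha>)" for \<alpha> :: "'n \<Rightarrow> nat"
    by (rule continuous_on_eq) (simp add: sphere_monomial_def)
  then show ?thesis unfolding p by (intro continuous_intros)
qed

text \<open>The link to the Stone-Weierstrass theorem. Linear functionals are combinations of
  coordinates, and sums and products stay polynomial at a suitable degree.\<close>

lemma real_polynomial_function_sphere_polys:
  fixes g :: "real ^ 'n \<Rightarrow> real"
  assumes "real_polynomial_function g"
  shows "\<exists>n. (\<lambda>x. if x \<in> sphere 0 1 then g x else 0) \<in> sphere_polys n"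
  using assms
proof (induction rule: real_polynomial_function.induct)
  case (linear f)
  have f: "f x = (\<Sum>i\<in>UNIV. f (axis i 1) * x $ i)" for x
  proof -
    have "f (\<Sum>i\<in>UNIV. x $ i *\<^sub>R axis i 1) = (\<Sum>i\<in>UNIV. f (axis i 1) * x $ i)"
      using bounded_linear.linear[OF linear] by (simp add: linear_sum linear_scale mult.commute)
    then show ?thesis by (simp only: scalar_mult_eq_scaleR[symmetric] basis_expansion)
  qed
  have "(\<lambda>x. \<Sum>i\<in>UNIV. f (axis i 1) * (if x \<in> sphere 0 1 then x $ i else 0)) \<in> sphere_polys 1"
    by (intro sphere_polys_sum sphere_polys_cmult sphere_polys_coordinate)
  moreover have "(if x \<in> sphere 0 1 then f x else 0) =
      (\<Sum>i\<in>UNIV. f (axis i 1) * (if x \<in> sphere 0 1 then x $ i else 0))" for x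
    by (subst f) simp
  ultimately show ?case by (intro exI[of _ 1]) presburger
next
  case (const c)
  show ?case using sphere_polys_const by blast
next
  case (add f g)
  then obtain m n where "(\<lambda>x. if x \<in> sphere 0 1 then f x else 0) \<in> sphere_polys m"
    "(\<lambda>x. if x \<in> sphere 0 1 then g x else 0) \<in> sphere_polys n" by blast
  then have "(\<lambda>x. (if x \<in> sphere 0 1 then f x else 0) + (if x \<in> sphere 0 1 then g x else 0))
      \<in> sphere_polys (max m n)"
    by (intro sphere_polys_add) (auto intro: sphere_polys_mono)
  moreover have "(if x \<in> sphere 0 1 then f x + g x else 0) =
      (if x \<in> sphere 0 1 then f x else 0) + (if x \<in> sphere 0 1 then g x else 0)" for x by simp
  ultimately show ?case by auto
next
  case (mult f g)
  then obtain m n where "(\<lambda>x. if x \<in> sphere 0 1 then f x else 0) \<in> sphere_polys m"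
    "(\<lambda>x. if x \<in> sphere 0 1 then g x else 0) \<in> sphere_polys n" by blast
  then have "(\<lambda>x. (if x \<in> sphere 0 1 then f x else 0) * (if x \<in> sphere 0 1 then g x else 0))
      \<in> sphere_polys (m + n)"
    by (rule sphere_polys_mult)
  moreover have "(if x \<in> sphere 0 1 then f x * g x else 0) =
      (if x \<in> sphere 0 1 then f x else 0) * (if x \<in> sphere 0 1 then g x else 0)" for x by simp
  ultimately show ?case by auto
qed

lemma trig_poly_great_circle:
  fixes x v :: "real ^ 'n"
  assumes "p \<in> sphere_polys N" "norm x = 1" "norm v = 1" "x \<bullet> v = 0"
  shows "trig_poly N (\<lambda>t. p (cos t *\<^sub>R x + sin t *\<^sub>R v))"
proof -
  obtain c where p: "p = (\<lambda>x. \<Sum>\<alpha> | (\<Sum>i\<in>UNIV. \<alpha> i) \<le> N. c \<alpha> * sphere_monomial \<alpha> x)"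
    using assms(1) unfolding sphere_polys_iff by blast
  have "p (cos t *\<^sub>R x + sin t *\<^sub>R v) = (\<Sum>\<alpha> | (\<Sum>i\<in>UNIV. \<alpha> i) \<le> N.
      c \<alpha> * (\<Prod>i\<in>UNIV. ((cos t *\<^sub>R x + sin t *\<^sub>R v) $ i) ^ \<alpha> i))" for t
    using unit_great_circle[OF assms(2-4), of t] by (simp add: p sphere_monomial_def)
  moreover have "trig_poly N (\<lambda>t. \<Sum>\<alpha> | (\<Sum>i\<in>UNIV. \<alpha> i) \<le> N.
      c \<alpha> * (\<Prod>i\<in>UNIV. ((cos t *\<^sub>R x + sin t *\<^sub>R v) $ i) ^ \<alpha> i))"
    by (intro trig_poly_sum finite_bounded_multi_indices trig_poly_cmult
        trig_poly_great_circle_monomial) simp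
  ultimately show ?thesis by presburger
qed

section \<open>The norming property of point sets with small fill-distance\<close>

lemma fill_distance_near_point:
  fixes Y :: "(real ^ 'n) set"
  assumes "finite Y" "fill_distance Y \<le> ereal r" "x \<in> sphere 0 1"
  obtains y where "y \<in> Y" "geodist x y \<le> r"
proof -
  have le: "(INF y\<in>Y. ereal (geodist x y)) \<le> ereal r"
    using assms(2,3) unfolding fill_distance_def SUP_le_iff by blast
  \<comment> \<open>The infimum over the empty set is infinite in \<open>ereal\<close>, which a real
    bound excludes. Over a nonempty finite set the infimum is attained.\<close>
  have "Y \<noteq> {}"
  proof
    assume "Y = {}"
    with le show False by (simp add: top_ereal_def)
  qed
  then have "(INF y\<in>Y. ereal (geodist x y)) = Min ((\<lambda>y. ereal (geodist x y)) ` Y)"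
    using assms(1) by (intro cInf_eq_Min) auto
  also have "\<dots> \<in> (\<lambda>y. ereal (geodist x y)) ` Y"
    using assms(1) \<open>Y \<noteq> {}\<close> by (intro Min_in) auto
  finally obtain y where "y \<in> Y" "(INF y\<in>Y. ereal (geodist x y)) = ereal (geodist x y)" by blast
  with le that show ?thesis by simp
qed

text \<open>Let |p| be maximal at z and let y be a point of Y near z. Along the great circle from z
  to y, the quotient of p by p(z) is a trigonometric polynomial bounded by 1 with value 1 at z, so
  the Riesz bound applies at y.\<close>

lemma sphere_poly_norming:
  fixes Y :: "(real ^ 'n) set"
  assumes p: "p \<in> sphere_polys N" and "N > 0" and Y: "finite Y" "Y \<subseteq> sphere 0 1"
    and fill: "fill_distance Y \<le> ereal (1 / (2 * real N))"
    and M: "\<And>y. y \<in> Y \<Longrightarrow> \<bar>p y\<bar> \<le> M" and x: "x \<in> sphere 0 1"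
  shows "\<bar>p x\<bar> \<le> 8 / 7 * M"
proof -
  have "continuous_on (sphere 0 1) (\<lambda>x. \<bar>p x\<bar>)"
    by (intro continuous_intros sphere_polys_continuous[OF p])
  then obtain z where z: "z \<in> sphere 0 1" and max: "\<And>u. u \<in> sphere 0 1 \<Longrightarrow> \<bar>p u\<bar> \<le> \<bar>p z\<bar>"
    using continuous_attains_sup[OF compact_sphere, of 0 1 "\<lambda>x. \<bar>p x\<bar>"] x by blast
  obtain y where y: "y \<in> Y" "geodist z y \<le> 1 / (2 * real N)"
    using fill_distance_near_point[OF Y(1) fill z] .
  define t where "t = geodist z y"
  have nz: "norm z = 1" "norm y = 1" using z y Y(2) by auto
  then have sq: "z \<bullet> z = 1" "y \<bullet> y = 1" by (auto simp: norm_eq_1)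
  have "\<bar>z \<bullet> y\<bar> \<le> 1" using Cauchy_Schwarz_ineq2[of z y] nz by simp
  then have zy: "z \<bullet> y = cos t" "0 \<le> t" "t \<le> pi"
    unfolding t_def geodist_def by (auto simp: arccos_lbound arccos_ubound)
  have Nt: "real N * t \<le> 1 / 2"
    using y(2) \<open>N > 0\<close> by (simp add: t_def field_simps)
  have "7 / 8 * \<bar>p z\<bar> \<le> \<bar>p y\<bar>"
  proof (cases "t = 0 \<or> p z = 0")
    case True
    have "t = 0 \<Longrightarrow> y = z"
      using zy(1) sq by (simp add: vector_eq[of y z] inner_commute[of y z])
    with True show ?thesis by auto
  next
    case False
    with zy have t: "0 < t" by simp
    have "t \<le> real N * t" using \<open>N > 0\<close> t by simp
    then have "t < pi" using Nt pi_gt3 by linarith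
    with t have st: "0 < sin t" by (rule sin_gt_zero)
    \<comment> \<open>The unit tangent vector at z in the direction of y; the great circle reaches y
      at parameter t.\<close>
    define v where "v = (y - cos t *\<^sub>R z) /\<^sub>R sin t"
    have yv: "y = cos t *\<^sub>R z + sin t *\<^sub>R v" using st by (simp add: v_def)
    have "z \<bullet> v = 0" by (simp add: v_def inner_diff_right zy sq)
    have "v \<bullet> v = ((y - cos t *\<^sub>R z) \<bullet> (y - cos t *\<^sub>R z)) / (sin t)\<^sup>2"
      by (simp add: v_def power2_eq_square divide_inverse)
    also have "(y - cos t *\<^sub>R z) \<bullet> (y - cos t *\<^sub>R z) = (sin t)\<^sup>2"
      by (simp add: inner_diff sq inner_commute[of y z] zy sin_squared_eq power2_eq_square algebra_simps)
    finally have "v \<bullet> v = 1" using st by simp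
    then have "norm v = 1" by (simp add: norm_eq_1)
    define q where "q u = 1 / p z * p (cos u *\<^sub>R z + sin u *\<^sub>R v)" for u
    have "cos (real N * t) \<le> q t"
    proof (rule riesz_lower_bound)
      show "trig_poly N q" unfolding q_def
        by (intro trig_poly_cmult trig_poly_great_circle[OF p]) fact+
      show "\<bar>q u\<bar> \<le> 1" for u
        using max[of "cos u *\<^sub>R z + sin u *\<^sub>R v"] False
          unit_great_circle[OF \<open>norm z = 1\<close> \<open>norm v = 1\<close> \<open>z \<bullet> v = 0\<close>, of u]
        by (simp add: q_def abs_mult field_simps)
      show "q 0 = 1" using False by (simp add: q_def)
    qed fact+
    \<comment> \<open>As N t \<le> 1/2, cos (N t) = 1 - 2 sin (N t / 2)^2 \<ge> 1 - 2/16.\<close>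
    moreover have "7 / 8 \<le> cos (real N * t)"
    proof -
      have "\<bar>sin (real N * t / 2)\<bar> \<le> \<bar>real N * t / 2\<bar>" by (rule abs_sin_x_le_abs_x)
      also have "\<dots> \<le> \<bar>1 / 4\<bar>"
        using Nt mult_nonneg_nonneg[of "real N" t] t by linarith
      finally have "(sin (real N * t / 2))\<^sup>2 \<le> (1 / 4)\<^sup>2" by (rule abs_le_square_iff[THEN iffD1])
      then show ?thesis using cos_double_sin[of "real N * t / 2"] by (simp add: power2_eq_square)
    qed
    moreover have "q t = p y / p z" by (simp add: q_def flip: yv)
    ultimately have "7 / 8 \<le> p y / p z" by linarith
    also have "\<dots> \<le> \<bar>p y\<bar> / \<bar>p z\<bar>" by (metis abs_divide abs_ge_self)
    finally show ?thesis using False by (simp add: field_simps)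
  qed
  with M[OF y(1)] max[OF x] show ?thesis by simp
qed


section \<open>Spherical harmonics\<close>

locale sphere_measure =
  fixes \<nu> :: "(real ^ 'n) measure"
  assumes invariant: "normalised_invariant_measure \<nu>"

sublocale sphere_measure \<subseteq> prob_space \<nu>
  using invariant by (simp add: normalised_invariant_measure_def)

context sphere_measure
begin

lemma space_sphere: "space \<nu> = sphere 0 1"
  using invariant by (simp add: normalised_invariant_measure_def)

lemma sets_sphere [measurable_cong]: "sets \<nu> = sets (restrict_space borel (sphere 0 1))"
  using invariant by (simp add: normalised_invariant_measure_def)

lemma measurable_continuous: "continuous_on (sphere 0 1) g \<Longrightarrow> g \<in> borel_measurable \<nu>"
  using borel_measurable_continuous_on_restrict measurable_cong_sets[OF sets_sphere refl] by blast

lemma continuous_bounded_on_sphere: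
  assumes "continuous_on (sphere 0 1) g"
  obtains K :: real where "K \<ge> 0" "\<And>x :: real ^ 'n. x \<in> sphere 0 1 \<Longrightarrow> \<bar>g x\<bar> \<le> K"
proof -
  have "bounded (g ` sphere 0 1)"
    using compact_continuous_image[OF assms compact_sphere] by (rule compact_imp_bounded)
  then obtain K where K: "\<And>x. x \<in> sphere 0 1 \<Longrightarrow> \<bar>g x\<bar> \<le> K"
    unfolding bounded_iff by (metis imageI real_norm_def)
  show ?thesis by (rule that[of "max K 0"]) (use K in \<open>auto simp: le_max_iff_disj\<close>)
qed

lemma integrable_continuous:
  assumes "continuous_on (sphere 0 1) g"
  shows "integrable \<nu> (g :: real ^ 'n \<Rightarrow> real)"
proof -
  obtain K where "\<And>x. x \<in> sphere 0 1 \<Longrightarrow> \<bar>g x\<bar> \<le> K"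
    using continuous_bounded_on_sphere[OF assms] by blast
  then show ?thesis
    by (intro integrable_const_bound[of _ K] measurable_continuous[OF assms] AE_I2)
       (simp add: space_sphere)
qed

text \<open>Rotations carry a cap to any other of the same radius, so one null cap makes all of them
  null. Finitely many cover the compact sphere, which has mass 1.\<close>

lemma emeasure_cap_nonzero:
  assumes x: "x \<in> sphere 0 1" and r: "r > 0"
  shows "emeasure \<nu> (ball x r \<inter> sphere 0 1) \<noteq> 0"
proof
  assume null: "emeasure \<nu> (ball x r \<inter> sphere 0 1) = 0"
  have cap: "ball y r \<inter> sphere 0 1 \<in> sets \<nu>" for y
    unfolding sets_sphere by (auto simp: sets_restrict_space)
  have "emeasure \<nu> (ball y r \<inter> sphere 0 1) = 0" if y: "y \<in> sphere 0 1" for y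
  proof -
    obtain T where T: "orthogonal_transformation T" "T x = y"
      using orthogonal_transformation_exists_1[of x y] x y by auto
    then have lin: "linear T" by (simp add: orthogonal_transformation_linear)
    have "T \<in> borel_measurable borel"
      using lin by (intro borel_measurable_continuous_onI) (simp add: linear_continuous_on linear_linear)
    then have "T \<in> measurable (restrict_space borel (sphere 0 1)) (restrict_space borel (sphere 0 1))"
      using T(1) by (intro measurable_restrict_space2 measurable_restrict_space1)
        (auto simp: orthogonal_transformation_norm)
    then have TM: "T \<in> measurable \<nu> \<nu>" by (simp cong: measurable_cong_sets add: sets_sphere)
    have "dist y (T z) = dist x z" for z
      unfolding T(2)[symmetric] dist_norm linear_diff[OF lin, symmetric]
      by (rule orthogonal_transformation_norm[OF T(1)])
    then have "T -` (ball y r \<inter> sphere 0 1) \<inter> space \<nu> = ball x r \<inter> sphere 0 1"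
      using orthogonal_transformation_norm[OF T(1)] by (auto simp: space_sphere)
    moreover have "emeasure \<nu> (ball y r \<inter> sphere 0 1) = emeasure (distr \<nu> \<nu> T) (ball y r \<inter> sphere 0 1)"
      using invariant T(1) by (simp add: normalised_invariant_measure_def)
    ultimately show ?thesis using null emeasure_distr[OF TM cap] by simp
  qed
  moreover obtain K :: "(real ^ 'n) set" where K: "K \<subseteq> sphere 0 1" "finite K" "sphere 0 1 \<subseteq> (\<Union>y\<in>K. ball y r)"
    by (rule compactE_image[OF compact_sphere, of "sphere 0 1" "\<lambda>y. ball y r"])
       (use r in \<open>auto intro: bexI[rotated]\<close>)
  ultimately have "(\<Union>y\<in>K. ball y r \<inter> sphere 0 1) \<in> null_sets \<nu>"
    using cap by (intro null_sets_UN' countable_finite null_setsI) blast+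
  moreover have "(\<Union>y\<in>K. ball y r \<inter> sphere 0 1) = space \<nu>" using K by (auto simp: space_sphere)
  ultimately show False using emeasure_space_1 by auto
qed

text \<open>By continuity a nonzero value persists on a whole cap, and caps are not null. This turns
  equality in L2 into equality at every point.\<close>

lemma continuous_square_integral_zero:
  assumes g: "continuous_on (sphere 0 1) g" and "(LINT x|\<nu>. (g x)\<^sup>2) = (0::real)" and x: "x \<in> sphere 0 1"
  shows "g x = 0"
proof (rule ccontr)
  assume "g x \<noteq> 0"
  have "integrable \<nu> (\<lambda>x. (g x)\<^sup>2)" by (intro integrable_continuous continuous_intros g)
  then have "AE x in \<nu>. (g x)\<^sup>2 = 0" using assms(2) by (subst (asm) integral_nonneg_eq_0_iff_AE) auto
  moreover obtain r where r: "r > 0" "\<And>y. y \<in> sphere 0 1 \<Longrightarrow> dist y x < r \<Longrightarrow> dist (g y) (g x) < \<bar>g x\<bar>"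
    using g x \<open>g x \<noteq> 0\<close> unfolding continuous_on_iff by (metis zero_less_abs_iff)
  have "g y \<noteq> 0" if "y \<in> ball x r" "y \<in> sphere 0 1" for y
    using r(2)[of y] that by (auto simp: dist_commute)
  ultimately have "AE y in \<nu>. y \<notin> ball x r \<inter> sphere 0 1" by (auto elim!: eventually_mono)
  then have "emeasure \<nu> (ball x r \<inter> sphere 0 1) = 0"
    by (subst (asm) AE_iff_null_sets[symmetric]) (auto simp: sets_sphere sets_restrict_space)
  with emeasure_cap_nonzero[OF x r(1)] show False by simp
qed

text \<open>Orthogonality lets any polynomial p be subtracted from one factor: the integral of g^2
  is that of g (g - p), which is at most e times the integral of |g| when p approximates g uniformly
  within e.\<close>

lemma polynomials_separate:
  assumes g: "continuous_on (sphere 0 1) g"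
    and orth: "\<And>n p. p \<in> sphere_polys n \<Longrightarrow> L2_inner \<nu> g p = 0" and x: "x \<in> sphere 0 1"
  shows "g x = 0"
proof (rule continuous_square_integral_zero[OF g _ x])
  have le: "(LINT x|\<nu>. (g x)\<^sup>2) \<le> e * (LINT x|\<nu>. \<bar>g x\<bar>)" if e: "e > 0" for e
  proof -
    obtain q where q: "real_polynomial_function q" "\<And>x. x \<in> sphere 0 1 \<Longrightarrow> \<bar>g x - q x\<bar> < e"
      using Stone_Weierstrass_real_polynomial_function[OF compact_sphere g e] by metis
    define p where "p x = (if x \<in> sphere 0 1 then q x else 0)" for x
    obtain n where p: "p \<in> sphere_polys n"
      using real_polynomial_function_sphere_polys[OF q(1)] unfolding p_def by blast
    note pc = sphere_polys_continuous[OF p]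
    have "(LINT x|\<nu>. (g x)\<^sup>2) = (LINT x|\<nu>. g x * (g x - p x)) + L2_inner \<nu> g p"
      unfolding L2_inner_def
      by (subst Bochner_Integration.integral_add[symmetric])
         (auto intro!: integrable_continuous continuous_intros g pc simp: algebra_simps power2_eq_square)
    also have "\<dots> = (LINT x|\<nu>. g x * (g x - p x))" by (simp add: orth[OF p])
    also have "\<dots> \<le> (LINT x|\<nu>. e * \<bar>g x\<bar>)"
    proof (rule integral_mono)
      fix x assume "x \<in> space \<nu>"
      then have "\<bar>g x - p x\<bar> \<le> e" using q(2)[of x] by (simp add: p_def space_sphere)
      then have "\<bar>g x\<bar> * \<bar>g x - p x\<bar> \<le> \<bar>g x\<bar> * e" by (rule mult_left_mono) simp
      then show "g x * (g x - p x) \<le> e * \<bar>g x\<bar>"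
        by (metis abs_ge_self abs_mult mult.commute order_trans)
    qed (intro integrable_continuous continuous_intros g pc)+
    finally show ?thesis by simp
  qed
  have "(LINT x|\<nu>. (g x)\<^sup>2) \<le> 0"
  proof (rule field_le_epsilon)
    fix e :: real assume "e > 0"
    define G where "G = (LINT x|\<nu>. \<bar>g x\<bar>)"
    have "G \<ge> 0" by (simp add: G_def)
    \<comment> \<open>The denominator G + 1 also covers the case G = 0.\<close>
    then have "e / (G + 1) * G \<le> e" using \<open>e > 0\<close> by (simp add: field_simps)
    moreover have "0 < e / (G + 1)" using \<open>e > 0\<close> \<open>G \<ge> 0\<close> by simp
    then have "(LINT x|\<nu>. (g x)\<^sup>2) \<le> e / (G + 1) * G" unfolding G_def by (rule le)
    ultimately show "(LINT x|\<nu>. (g x)\<^sup>2) \<le> 0 + e" by simp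
  qed
  then show "(LINT x|\<nu>. (g x)\<^sup>2) = 0" by (intro antisym) auto
qed

lemma L2_inner_commute: "L2_inner \<nu> f g = L2_inner \<nu> g f"
  by (simp add: L2_inner_def mult.commute)

lemma L2_inner_cmult_left: "L2_inner \<nu> (\<lambda>x. c * f x) g = c * L2_inner \<nu> f g"
  by (simp add: L2_inner_def mult.assoc)

lemma L2_inner_diff_left:
  assumes "continuous_on (sphere 0 1) f" "continuous_on (sphere 0 1) g" "continuous_on (sphere 0 1) h"
  shows "L2_inner \<nu> (\<lambda>x. f x - g x) h = L2_inner \<nu> f h - L2_inner \<nu> g h"
  unfolding L2_inner_def left_diff_distrib
  by (intro Bochner_Integration.integral_diff integrable_continuous continuous_intros assms)

lemma L2_inner_sum_left:
  assumes "\<And>i. i \<in> I \<Longrightarrow> continuous_on (sphere 0 1) (f i)" "continuous_on (sphere 0 1) h"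
  shows "L2_inner \<nu> (\<lambda>x. \<Sum>i\<in>I. f i x) h = (\<Sum>i\<in>I. L2_inner \<nu> (f i) h)"
  unfolding L2_inner_def sum_distrib_right
  by (intro Bochner_Integration.integral_sum integrable_continuous continuous_intros assms)

end

section \<open>Fourier expansion with respect to an orthonormal basis of harmonics\<close>

locale harmonic_basis = sphere_measure \<nu> for \<nu> :: "(real ^ 'n) measure" +
  fixes m :: "nat \<Rightarrow> nat" and B :: "nat \<Rightarrow> nat \<Rightarrow> real ^ 'n \<Rightarrow> real"
  assumes basis: "orthonormal_basis_of \<nu> (harmonics \<nu> n) (m n) (B n)"
begin

lemma basis_harmonic: "j \<in> {1..m n} \<Longrightarrow> B n j \<in> harmonics \<nu> n"
  using basis by (simp add: orthonormal_basis_of_def)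

lemma basis_poly: "j \<in> {1..m n} \<Longrightarrow> B n j \<in> sphere_polys n"
  using basis_harmonic by (auto simp: harmonics_def)

lemma basis_continuous: "j \<in> {1..m n} \<Longrightarrow> continuous_on (sphere 0 1) (B n j)"
  using basis_poly sphere_polys_continuous by blast

lemma harmonics_orthogonal:
  assumes "p \<in> harmonics \<nu> n" "q \<in> sphere_polys k" "k < n"
  shows "L2_inner \<nu> p q = 0"
proof (cases n)
  case (Suc l)
  with assms show ?thesis
    using sphere_polys_mono[of q k l] by (simp add: harmonics_def)
qed (use assms in simp)

lemma basis_orthonormal:
  assumes "i \<in> {1..m n}" "j \<in> {1..m k}"
  shows "L2_inner \<nu> (B n i) (B k j) = (if n = k \<and> i = j then 1 else 0)"
proof (cases n k rule: linorder_cases)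
  case less
  then show ?thesis
    using harmonics_orthogonal[OF basis_harmonic basis_poly] assms by (auto simp: L2_inner_commute)
next
  case equal
  then show ?thesis using basis[of n] assms by (simp add: orthonormal_basis_of_def)
next
  case greater
  then show ?thesis
    using harmonics_orthogonal[OF basis_harmonic basis_poly] assms by auto
qed

definition harmonic_sum :: "(nat \<Rightarrow> nat \<Rightarrow> real) \<Rightarrow> nat \<Rightarrow> real ^ 'n \<Rightarrow> real"
  where "harmonic_sum c n x = (\<Sum>j=1..m n. c n j * B n j x)"

lemma harmonics_expansion:
  assumes "p \<in> harmonics \<nu> n"
  obtains c where "p = harmonic_sum (\<lambda>_. c) n"
  using basis[of n] assms unfolding orthonormal_basis_of_def harmonic_sum_def[abs_def] fun_eq_iff
  by blast

lemma harmonic_sum_poly: "harmonic_sum c n \<in> sphere_polys n"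
  unfolding harmonic_sum_def[abs_def] by (intro sphere_polys_sum sphere_polys_cmult basis_poly)

lemma harmonic_sum_continuous: "continuous_on (sphere 0 1) (harmonic_sum c n)"
  using harmonic_sum_poly by (rule sphere_polys_continuous)

lemma partial_sums_continuous: "continuous_on (sphere 0 1) (\<lambda>x. \<Sum>k\<in>K. harmonic_sum c k x)"
  by (intro continuous_intros harmonic_sum_continuous)

lemma harmonic_sum_inner:
  assumes "j \<in> {1..m k}"
  shows "L2_inner \<nu> (harmonic_sum c n) (B k j) = (if n = k then c k j else 0)"
proof -
  have "L2_inner \<nu> (harmonic_sum c n) (B k j) = (\<Sum>i=1..m n. c n i * L2_inner \<nu> (B n i) (B k j))"
    unfolding harmonic_sum_def[abs_def]
    by (subst L2_inner_sum_left)
       (auto intro!: continuous_intros basis_continuous assms simp: L2_inner_cmult_left)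
  also have "\<dots> = (\<Sum>i=1..m n. if i = j then (if n = k then c k j else 0) else 0)"
    by (rule sum.cong) (use assms basis_orthonormal in auto)
  also have "\<dots> = (if n = k then c k j else 0)" using assms by simp
  finally show ?thesis .
qed

lemma partial_sums_inner:
  assumes "finite K" "j \<in> {1..m k}"
  shows "L2_inner \<nu> (\<lambda>x. \<Sum>n\<in>K. harmonic_sum c n x) (B k j) = (if k \<in> K then c k j else 0)"
proof -
  have "L2_inner \<nu> (\<lambda>x. \<Sum>n\<in>K. harmonic_sum c n x) (B k j) =
      (\<Sum>n\<in>K. L2_inner \<nu> (harmonic_sum c n) (B k j))"
    by (intro L2_inner_sum_left harmonic_sum_continuous basis_continuous assms)
  also have "\<dots> = (\<Sum>n\<in>K. if n = k then c k j else 0)"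
    by (intro sum.cong refl harmonic_sum_inner assms)
  also have "\<dots> = (if k \<in> K then c k j else 0)" using assms(1) by simp
  finally show ?thesis .
qed

lemma inner_partial_sums:
  assumes "continuous_on (sphere 0 1) f"
  shows "L2_inner \<nu> f (\<lambda>x. \<Sum>n\<in>K. harmonic_sum c n x) =
    (\<Sum>n\<in>K. \<Sum>j=1..m n. c n j * L2_inner \<nu> f (B n j))"
proof -
  have "L2_inner \<nu> (\<lambda>x. \<Sum>n\<in>K. harmonic_sum c n x) f = (\<Sum>n\<in>K. L2_inner \<nu> (harmonic_sum c n) f)"
    by (intro L2_inner_sum_left harmonic_sum_continuous assms)
  also have "\<dots> = (\<Sum>n\<in>K. \<Sum>j=1..m n. L2_inner \<nu> (\<lambda>x. c n j * B n j x) f)"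
    unfolding harmonic_sum_def[abs_def]
    by (intro sum.cong refl L2_inner_sum_left continuous_intros basis_continuous assms)
  finally show ?thesis by (simp add: L2_inner_commute[of f] L2_inner_cmult_left)
qed

lemma partial_sums_L2:
  assumes "finite K"
  shows "(LINT x|\<nu>. (\<Sum>n\<in>K. harmonic_sum c n x)\<^sup>2) = (\<Sum>n\<in>K. \<Sum>j=1..m n. (c n j)\<^sup>2)"
proof -
  have "(LINT x|\<nu>. (\<Sum>n\<in>K. harmonic_sum c n x)\<^sup>2) =
      L2_inner \<nu> (\<lambda>x. \<Sum>n\<in>K. harmonic_sum c n x) (\<lambda>x. \<Sum>n\<in>K. harmonic_sum c n x)"
    by (simp add: L2_inner_def power2_eq_square)
  also have "\<dots> = (\<Sum>n\<in>K. \<Sum>j=1..m n. (c n j)\<^sup>2)"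
    unfolding inner_partial_sums[OF partial_sums_continuous]
    by (intro sum.cong refl) (simp add: partial_sums_inner[OF assms] power2_eq_square)
  finally show ?thesis .
qed

text \<open>Subtracting from p its Fourier sum up to degree n leaves a remainder orthogonal to the
  bases of degree at most n. By induction these span \<open>sphere_polys n\<close>, so the remainder
  is a harmonic of degree n + 1.\<close>

lemma sphere_polys_expansion:
  assumes "p \<in> sphere_polys n"
  shows "\<exists>c. p = (\<lambda>x. \<Sum>k\<le>n. harmonic_sum c k x)"
  using assms
proof (induction n arbitrary: p)
  case 0
  then have "p \<in> harmonics \<nu> 0" by (simp add: harmonics_def L2_inner_def)
  then obtain c where "p = harmonic_sum (\<lambda>_. c) 0" by (rule harmonics_expansion)
  then show ?case by (intro exI[of _ "\<lambda>_. c"]) (simp add: fun_eq_iff)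
next
  case (Suc n)
  define b where "b k j = L2_inner \<nu> p (B k j)" for k j
  define q where "q x = (\<Sum>k\<le>n. harmonic_sum b k x)" for x
  have pc: "continuous_on (sphere 0 1) p" using Suc.prems by (rule sphere_polys_continuous)
  have q: "q \<in> sphere_polys n" unfolding q_def[abs_def]
    by (intro sphere_polys_sum sphere_polys_mono[OF harmonic_sum_poly]) simp
  have r: "(\<lambda>x. p x - q x) \<in> sphere_polys (Suc n)"
    using sphere_polys_add[OF Suc.prems sphere_polys_cmult[OF sphere_polys_mono[OF q], of "Suc n" "-1"]]
    by simp
  have "L2_inner \<nu> (\<lambda>x. p x - q x) u = 0" if u: "u \<in> sphere_polys n" for u
  proof -
    obtain c where c: "u = (\<lambda>x. \<Sum>k\<le>n. harmonic_sum c k x)" using Suc.IH[OF u] by blast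
    have "L2_inner \<nu> (\<lambda>x. p x - q x) (B k j) = 0" if "k \<le> n" "j \<in> {1..m k}" for k j
    proof -
      have "L2_inner \<nu> q (B k j) = b k j"
        using that unfolding q_def[abs_def] by (subst partial_sums_inner) auto
      then show ?thesis
        using L2_inner_diff_left[OF pc sphere_polys_continuous[OF q] basis_continuous[OF that(2)]]
        by (simp add: b_def)
    qed
    then show ?thesis unfolding c by (simp add: inner_partial_sums[OF sphere_polys_continuous[OF r]])
  qed
  with r have "(\<lambda>x. p x - q x) \<in> harmonics \<nu> (Suc n)" by (simp add: harmonics_def)
  then obtain c where c: "(\<lambda>x. p x - q x) = harmonic_sum (\<lambda>_. c) (Suc n)"
    by (rule harmonics_expansion)
  have "p x = (\<Sum>k\<le>Suc n. harmonic_sum (b(Suc n := c)) k x)" for x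
  proof -
    have "(\<Sum>k\<le>n. harmonic_sum (b(Suc n := c)) k x) = q x"
      unfolding q_def by (intro sum.cong) (auto simp: harmonic_sum_def)
    moreover have "harmonic_sum (b(Suc n := c)) (Suc n) x = p x - q x"
      using fun_cong[OF c, of x] by (simp add: harmonic_sum_def)
    ultimately show ?thesis by simp
  qed
  then show ?case by blast
qed

abbreviation coeff_of :: "(real ^ 'n \<Rightarrow> real) \<Rightarrow> nat \<Rightarrow> nat \<Rightarrow> real"
  where "coeff_of f n j \<equiv> L2_inner \<nu> f (B n j)"

text \<open>The projection is a definite description, so uniqueness has to be shown as well: a
  competitor expands in the basis of degree n, and testing against each basis element fixes its
  coefficients.\<close>

lemma harm_proj_eq:
  assumes f: "continuous_on (sphere 0 1) f"
  shows "harm_proj \<nu> n f = harmonic_sum (coeff_of f) n"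
  unfolding harm_proj_def
proof (rule the_equality)
  have "harmonic_sum (coeff_of f) n \<in> harmonics \<nu> n"
  proof -
    have "L2_inner \<nu> (harmonic_sum (coeff_of f) n) q = 0" if "q \<in> sphere_polys l" "n = Suc l" for q l
    proof -
      obtain c where q: "q = (\<lambda>x. \<Sum>k\<le>l. harmonic_sum c k x)"
        using sphere_polys_expansion[OF \<open>q \<in> sphere_polys l\<close>] by blast
      show ?thesis unfolding q inner_partial_sums[OF harmonic_sum_continuous]
        using \<open>n = Suc l\<close> by (intro sum.neutral ballI) (simp add: harmonic_sum_inner)
    qed
    then show ?thesis
      by (auto simp: harmonics_def harmonic_sum_poly L2_inner_def split: nat.split)
  qed
  moreover have "L2_inner \<nu> (\<lambda>x. f x - harmonic_sum (coeff_of f) n x) q = 0" if "q \<in> harmonics \<nu> n" for q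
  proof -
    obtain c where "q = harmonic_sum (\<lambda>_. c) n" using \<open>q \<in> harmonics \<nu> n\<close> by (rule harmonics_expansion)
    then have q: "q = (\<lambda>x. \<Sum>k\<in>{n}. harmonic_sum (\<lambda>_. c) k x)" by simp
    have "L2_inner \<nu> (\<lambda>x. f x - harmonic_sum (coeff_of f) n x) (B n j) = 0" if "j \<in> {1..m n}" for j
      using L2_inner_diff_left[OF f harmonic_sum_continuous basis_continuous[OF that]]
        harmonic_sum_inner[OF that] by simp
    then show ?thesis unfolding q
      by (subst inner_partial_sums) (auto intro!: continuous_intros f harmonic_sum_continuous)
  qed
  ultimately show "harmonic_sum (coeff_of f) n \<in> harmonics \<nu> n \<and>
      (\<forall>q\<in>harmonics \<nu> n. L2_inner \<nu> (\<lambda>x. f x - harmonic_sum (coeff_of f) n x) q = 0)" by blast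
next
  fix g assume g: "g \<in> harmonics \<nu> n \<and> (\<forall>q\<in>harmonics \<nu> n. L2_inner \<nu> (\<lambda>x. f x - g x) q = 0)"
  then obtain c where gc: "g = harmonic_sum (\<lambda>_. c) n" using harmonics_expansion by blast
  have "c j = coeff_of f n j" if j: "j \<in> {1..m n}" for j
  proof -
    have "L2_inner \<nu> (\<lambda>x. f x - g x) (B n j) = 0" using g basis_harmonic[OF j] by blast
    then show ?thesis
      using L2_inner_diff_left[OF f harmonic_sum_continuous basis_continuous[OF j]]
        harmonic_sum_inner[OF j] unfolding gc by simp
  qed
  then show "g = harmonic_sum (coeff_of f) n" unfolding gc by (simp add: harmonic_sum_def fun_eq_iff)
qed

lemma harm_proj_norm:
  assumes "continuous_on (sphere 0 1) f"
  shows "(L2_nrm \<nu> (harm_proj \<nu> n f))\<^sup>2 = (\<Sum>j=1..m n. (coeff_of f n j)\<^sup>2)"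
  using partial_sums_L2[of "{n}" "coeff_of f"]
  by (simp add: L2_nrm_def harm_proj_eq[OF assms] sum_nonneg)

lemma pseudodiff_basis:
  assumes j: "j \<in> {1..m n}"
  shows "pseudodiff \<nu> lam (B n j) x = lam n * B n j x"
proof -
  have "harm_proj \<nu> k (B n j) x = (if k = n then B n j x else 0)" for k
  proof -
    have "harm_proj \<nu> k (B n j) x = (\<Sum>i=1..m k. coeff_of (B n j) k i * B k i x)"
      by (simp only: harm_proj_eq[OF basis_continuous[OF j]] harmonic_sum_def)
    also have "\<dots> = (\<Sum>i=1..m k. if i = j then if k = n then B n j x else 0 else 0)"
      by (rule sum.cong) (use j basis_orthonormal in auto)
    also have "\<dots> = (if k = n then B n j x else 0)" using j by simp
    finally show ?thesis .
  qed
  then have "pseudodiff \<nu> lam (B n j) x = (\<Sum>k. if k = n then lam n * B n j x else 0)"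
    unfolding pseudodiff_def by (intro arg_cong[where f = suminf]) auto
  also have "\<dots> = lam n * B n j x"
    using sums_single[of n "\<lambda>_. lam n * B n j x"] by (simp add: sums_iff)
  finally show ?thesis .
qed

text \<open>A basis harmonic of degree n is an eigenfunction of the operator with eigenvalue
  \<open>lam n\<close>, so the inequality reads \<open>lam n\<close> L \<le> E \<open>lam n\<close>
  L for its supremum norm L.\<close>

lemma bernstein_constant_ge_1:
  assumes "m n \<noteq> 0" and lam: "lam n > 0"
    and bern: "\<And>p. p \<in> sphere_polys n \<Longrightarrow>
      Linf_nrm \<nu> (pseudodiff \<nu> lam p) \<le> ereal (E * lam n) * Linf_nrm \<nu> p"
  shows "E \<ge> 1"
proof -
  define b where "b = B n 1"
  have 1: "1 \<in> {1..m n}" using assms(1) by simp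
  have bc: "continuous_on (sphere 0 1) b" unfolding b_def by (rule basis_continuous[OF 1])
  have meas: "(\<lambda>x. ereal \<bar>b x\<bar>) \<in> borel_measurable \<nu>"
    using measurable_continuous[OF bc] by measurable
  obtain K where K: "\<And>x. x \<in> sphere 0 1 \<Longrightarrow> \<bar>b x\<bar> \<le> K"
    using continuous_bounded_on_sphere[OF bc] by blast
  define L where "L = Linf_nrm \<nu> b"
  have "L \<le> ereal K"
    unfolding L_def Linf_nrm_def using K by (intro esssup_I meas AE_I2) (simp add: space_sphere)
  \<comment> \<open>Cancelling L in \<open>ereal\<close> requires it to be finite and positive; L =
    0 would contradict the unit L2 norm of \<open>b\<close>.\<close>
  moreover have "L > 0"
  proof (rule ccontr)
    assume "\<not> 0 < L"
    have "AE x in \<nu>. ereal \<bar>b x\<bar> \<le> L" unfolding L_def Linf_nrm_def by (rule esssup_AE)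
    then have "AE x in \<nu>. (b x)\<^sup>2 = 0"
    proof eventually_elim
      case (elim x)
      also have "L \<le> ereal 0" using \<open>\<not> 0 < L\<close> by (simp add: zero_ereal_def)
      finally show ?case by simp
    qed
    then have "(LINT x|\<nu>. (b x)\<^sup>2) = 0" by (rule integral_eq_zero_AE)
    then show False
      using basis_orthonormal[OF 1 1] by (simp add: b_def L2_inner_def power2_eq_square)
  qed
  ultimately obtain l where l: "L = ereal l" "l > 0" by (cases L) auto
  have "Linf_nrm \<nu> (pseudodiff \<nu> lam b) = esssup \<nu> (\<lambda>x. ereal (lam n) * ereal \<bar>b x\<bar>)"
    unfolding Linf_nrm_def b_def
    by (simp only: pseudodiff_basis[OF 1] abs_mult abs_of_pos[OF lam] times_ereal.simps)
  also have "\<dots> = ereal (lam n * l)"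
    using esssup_cmult[OF lam, of \<nu> "\<lambda>x. ereal \<bar>b x\<bar>"] l(1)
    by (simp add: L_def Linf_nrm_def)
  finally have "ereal (lam n * l) \<le> ereal (E * lam n) * ereal l"
    using bern[OF basis_poly[OF 1]] l(1) by (simp add: L_def b_def)
  then show ?thesis using lam l(2) by simp
qed

end


section \<open>Estimates for series and symbols\<close>

lemma series_cauchy_schwarz:
  fixes u v :: "nat \<Rightarrow> real"
  assumes u: "summable (\<lambda>n. (u n)\<^sup>2)" and v: "summable (\<lambda>n. (v n)\<^sup>2)"
  shows "summable (\<lambda>n. \<bar>u n * v n\<bar>)"
    and "(\<Sum>n. \<bar>u n * v n\<bar>) \<le> sqrt (\<Sum>n. (u n)\<^sup>2) * sqrt (\<Sum>n. (v n)\<^sup>2)"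
proof -
  have bound: "(\<Sum>n<k. \<bar>u n * v n\<bar>) \<le> sqrt (\<Sum>n. (u n)\<^sup>2) * sqrt (\<Sum>n. (v n)\<^sup>2)" for k
  proof -
    have "(\<Sum>n<k. \<bar>u n\<bar> * \<bar>v n\<bar>)\<^sup>2 \<le> (\<Sum>n<k. \<bar>u n\<bar>\<^sup>2) * (\<Sum>n<k. \<bar>v n\<bar>\<^sup>2)"
      by (rule Cauchy_Schwarz_ineq_sum)
    also have "\<dots> \<le> (\<Sum>n. (u n)\<^sup>2) * (\<Sum>n. (v n)\<^sup>2)"
      by (intro mult_mono) (auto intro!: sum_le_suminf u v suminf_nonneg sum_nonneg)
    finally have "\<bar>\<Sum>n<k. \<bar>u n\<bar> * \<bar>v n\<bar>\<bar> \<le> sqrt ((\<Sum>n. (u n)\<^sup>2) * (\<Sum>n. (v n)\<^sup>2))"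
      by (rule real_le_rsqrt[of "\<bar>_\<bar>", simplified power2_abs])
    then show ?thesis by (simp add: abs_mult real_sqrt_mult)
  qed
  show s: "summable (\<lambda>n. \<bar>u n * v n\<bar>)"
  proof (rule summableI_nonneg_bounded)
    show "(\<Sum>n<k. \<bar>u n * v n\<bar>) \<le> sqrt (\<Sum>n. (u n)\<^sup>2) * sqrt (\<Sum>n. (v n)\<^sup>2)" for k
      by (rule bound)
  qed simp
  show "(\<Sum>n. \<bar>u n * v n\<bar>) \<le> sqrt (\<Sum>n. (u n)\<^sup>2) * sqrt (\<Sum>n. (v n)\<^sup>2)"
    using s bound by (rule suminf_le_const)
qed

text \<open>Translates the unordered tail sums of the final statement into the shifted series used
  in the estimates.\<close>

lemma infsum_greaterThan_eq_suminf:
  fixes g :: "nat \<Rightarrow> real"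
  assumes "summable g" "\<And>n. g n \<ge> 0"
  shows "(\<Sum>\<^sub>\<infinity>n\<in>{N<..}. g n) = (\<Sum>n. g (n + Suc N))"
proof -
  have "(\<lambda>n. n + Suc N) ` UNIV = {N<..}"
  proof (intro subset_antisym subsetI)
    fix k assume "k \<in> {N<..}"
    then have "k = (k - Suc N) + Suc N" by simp
    then show "k \<in> (\<lambda>n. n + Suc N) ` UNIV" by (rule image_eqI) simp
  qed auto
  then have "(\<Sum>\<^sub>\<infinity>n\<in>{N<..}. g n) = infsum (g \<circ> (\<lambda>n. n + Suc N)) UNIV"
    using infsum_reindex[of "\<lambda>n. n + Suc N" UNIV g] by (simp add: inj_on_def)
  also have "\<dots> = (\<Sum>n. g (n + Suc N))"
  proof (rule infsumI)
    have "summable (\<lambda>n. g (n + Suc N))" using assms(1) by (simp only: summable_iff_shift)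
    then have "((\<lambda>n. g (n + Suc N)) has_sum (\<Sum>n. g (n + Suc N))) UNIV"
      using assms(2) by (intro norm_summable_imp_has_sum) (auto simp del: add_Suc_right)
    then show "(g \<circ> (\<lambda>n. n + Suc N) has_sum (\<Sum>n. g (n + Suc N))) UNIV" by (simp add: o_def)
  qed
  finally show ?thesis .
qed

lemma symbol_nonneg: "symbol d s n \<ge> 0"
  by (simp add: symbol_def)

text \<open>Degree 1 is left out because d + n - 2 vanishes for d = n = 1.\<close>

lemma symbol_pos: "d \<ge> 1 \<Longrightarrow> n \<ge> 2 \<Longrightarrow> symbol d s n > 0"
  by (simp add: symbol_def)

lemma mono_symbol:
  assumes "d \<ge> 1" "s > 0"
  shows "mono (symbol d s)"
proof (rule monoI)
  fix n k :: nat assume "n \<le> k"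
  show "symbol d s n \<le> symbol d s k"
  proof (cases "n = 0")
    \<comment> \<open>Here d + n - 2 may be negative, but the product is 0, and so is its
      power.\<close>
    case True
    then show ?thesis by (simp add: symbol_def)
  next
    case False
    with \<open>n \<le> k\<close> assms show ?thesis
      unfolding symbol_def by (intro powr_mono2 mult_mono mult_nonneg_nonneg) auto
  qed
qed


section \<open>The interpolation error\<close>

locale zonal_basis = harmonic_basis \<nu> m B
  for \<nu> :: "(real ^ 'n) measure" and m :: "nat \<Rightarrow> nat" and B :: "nat \<Rightarrow> nat \<Rightarrow> real ^ 'n \<Rightarrow> real" +
  fixes C :: "nat \<Rightarrow> real poly"
  assumes kernel: "\<lbrakk>x \<in> sphere 0 1; y \<in> sphere 0 1\<rbrakk> \<Longrightarrow>
    poly (C n) (x \<bullet> y) = (\<Sum>j=1..m n. B n j x * B n j y)"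
begin

text \<open>On the diagonal the zonal kernel has argument 1, so the sum is constant on the sphere.
  Integrating it adds up \<open>m n\<close> unit norms.\<close>

lemma basis_square_sum:
  assumes x: "x \<in> sphere 0 1"
  shows "(\<Sum>j=1..m n. (B n j x)\<^sup>2) = real (m n)"
proof -
  have const: "(\<Sum>j=1..m n. (B n j y)\<^sup>2) = poly (C n) 1" if "y \<in> sphere 0 1" for y
    using kernel[OF that that, of n] that by (simp add: norm_eq_1 power2_eq_square)
  have "poly (C n) 1 = (LINT y|\<nu>. poly (C n) 1)" by (simp add: prob_space)
  also have "\<dots> = (LINT y|\<nu>. (\<Sum>j=1..m n. (B n j y)\<^sup>2))"
    by (rule Bochner_Integration.integral_cong) (simp_all only: space_sphere const)
  also have "\<dots> = (\<Sum>j=1..m n. (LINT y|\<nu>. (B n j y)\<^sup>2))"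
    by (intro Bochner_Integration.integral_sum integrable_continuous continuous_intros basis_continuous)
  also have "\<dots> = (\<Sum>j=1..m n. 1)"
    using basis_orthonormal[of _ n _ n]
    by (intro sum.cong) (auto simp: L2_inner_def power2_eq_square)
  finally show ?thesis using const[OF x] by simp
qed

text \<open>A single basis function would have square 1 everywhere. On the connected sphere it would
  then be constant, yet for n \<ge> 1 it is orthogonal to constants.\<close>

lemma harmonic_dim_not_one:
  assumes "CARD('n) \<ge> 2" "n \<ge> 1"
  shows "m n \<noteq> 1"
proof
  assume 1: "m n = 1"
  define b where "b = B n 1"
  have b2: "b x = 1 \<or> b x = - 1" if "x \<in> sphere 0 1" for x
    using basis_square_sum[OF that, of n] by (simp add: 1 b_def power2_eq_1_iff)
  have bc: "continuous_on (sphere 0 1) b" using basis_continuous[of 1 n] by (simp add: b_def 1)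
  have "b ` sphere 0 1 \<subseteq> {1, - 1}" using b2 by blast
  then have "finite (b ` sphere 0 1)" by (rule finite_subset) simp
  moreover have "connected (sphere 0 1 :: (real ^ 'n) set)"
    using assms(1) by (intro connected_sphere) simp
  ultimately obtain c where c: "\<And>x. x \<in> sphere 0 1 \<Longrightarrow> b x = c"
    using bc continuous_finite_range_constant unfolding constant_on_def by blast
  have "(\<lambda>x. if x \<in> sphere 0 1 then 1 else 0) \<in> sphere_polys 0" by (rule sphere_polys_const)
  then have "L2_inner \<nu> b (\<lambda>x. if x \<in> sphere 0 1 then 1 else 0) = 0"
    unfolding b_def using assms(2) 1 by (intro harmonics_orthogonal[OF basis_harmonic]) auto
  moreover have "L2_inner \<nu> b (\<lambda>x. if x \<in> sphere 0 1 then 1 else 0) = (LINT x|\<nu>. c)"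
    unfolding L2_inner_def
    by (rule Bochner_Integration.integral_cong) (auto simp: space_sphere c)
  ultimately have "c = 0" by (simp add: prob_space)
  moreover obtain x :: "real ^ 'n" where "x \<in> sphere 0 1"
    using not_empty unfolding space_sphere by blast
  ultimately show False using b2 c by fastforce
qed

text \<open>By \<open>partial_sums_L2\<close> this is the squared L2 norm of
  \<open>harmonic_sum c n\<close>.\<close>

definition energy :: "(nat \<Rightarrow> nat \<Rightarrow> real) \<Rightarrow> nat \<Rightarrow> real"
  where "energy c n = (\<Sum>j=1..m n. (c n j)\<^sup>2)"

lemma energy_nonneg [simp]: "0 \<le> energy c n"
  by (simp add: energy_def sum_nonneg)

lemma inner_le_energy: "\<bar>\<Sum>j=1..m n. b n j * c n j\<bar> \<le> sqrt (energy b n) * sqrt (energy c n)"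
  unfolding real_sqrt_mult[symmetric] energy_def
  by (rule real_le_rsqrt) (simp only: power2_abs Cauchy_Schwarz_ineq_sum)

lemma harmonic_sum_bound:
  assumes "x \<in> sphere 0 1"
  shows "\<bar>harmonic_sum c n x\<bar> \<le> sqrt (energy c n) * sqrt (real (m n))"
  using inner_le_energy[of c n "\<lambda>n j. B n j x"] basis_square_sum[OF assms, of n]
  by (simp add: harmonic_sum_def energy_def)

text \<open>Each term is the product of the square roots of \<open>energy c n / a n\<close> and
  \<open>m n * a n\<close>, so Cauchy-Schwarz applies. The shift k serves the tails.\<close>

lemma weighted_bound:
  assumes a: "\<And>n. a n > 0" and ma: "summable (\<lambda>n. real (m n) * a n)"
    and c: "summable (\<lambda>n. energy c n / a n)"
  shows "summable (\<lambda>n. sqrt (energy c n) * sqrt (real (m n)))"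
    and "(\<Sum>n. sqrt (energy c (n + k)) * sqrt (real (m (n + k)))) \<le>
      sqrt (\<Sum>n. real (m (n + k)) * a (n + k)) * sqrt (\<Sum>n. energy c (n + k) / a (n + k))"
proof -
  define u where "u n = sqrt (energy c n / a n)" for n
  define v where "v n = sqrt (real (m n) * a n)" for n
  have uv: "sqrt (energy c n) * sqrt (real (m n)) = \<bar>v n * u n\<bar>" for n
    using a[of n] by (simp add: u_def v_def real_sqrt_mult real_sqrt_divide abs_mult)
  have u2: "(u n)\<^sup>2 = energy c n / a n" and v2: "(v n)\<^sup>2 = real (m n) * a n" for n
    using a[of n] by (simp_all add: u_def v_def)
  show "summable (\<lambda>n. sqrt (energy c n) * sqrt (real (m n)))"
    unfolding uv by (rule series_cauchy_schwarz) (simp_all only: u2 v2 c ma)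
  show "(\<Sum>n. sqrt (energy c (n + k)) * sqrt (real (m (n + k)))) \<le>
      sqrt (\<Sum>n. real (m (n + k)) * a (n + k)) * sqrt (\<Sum>n. energy c (n + k) / a (n + k))"
    using series_cauchy_schwarz(2)[of "\<lambda>n. v (n + k)" "\<lambda>n. u (n + k)"]
      summable_ignore_initial_segment[OF c, of k] summable_ignore_initial_segment[OF ma, of k]
    unfolding uv u2 v2 by blast
qed

text \<open>The Weierstrass test gives a continuous sum F of the Fourier series. Integrating term by
  term, under the same majorants, F has the coefficients of f, and completeness of the polynomials
  yields f = F.\<close>

lemma harmonic_expansion:
  assumes a: "\<And>n. a n > 0" and ma: "summable (\<lambda>n. real (m n) * a n)"
    and f: "continuous_on (sphere 0 1) f"
    and fin: "summable (\<lambda>n. energy (coeff_of f) n / a n)" and x: "x \<in> sphere 0 1"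
  shows "(\<lambda>n. harmonic_sum (coeff_of f) n x) sums f x"
proof -
  define M where "M n = sqrt (energy (coeff_of f) n) * sqrt (real (m n))" for n
  define F where "F x = (\<Sum>n. harmonic_sum (coeff_of f) n x)" for x
  have M: "summable M" unfolding M_def[abs_def] using weighted_bound(1)[OF a ma fin] .
  have bound: "\<bar>harmonic_sum (coeff_of f) n x\<bar> \<le> M n" if "x \<in> sphere 0 1" for n x
    unfolding M_def using that by (rule harmonic_sum_bound)
  have summ: "summable (\<lambda>n. harmonic_sum (coeff_of f) n x)" if "x \<in> sphere 0 1" for x
    using bound[OF that] by (intro summable_comparison_test'[OF M, of 0]) simp
  have "uniform_limit (sphere 0 1) (\<lambda>n x. \<Sum>i<n. harmonic_sum (coeff_of f) i x) F sequentially"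
    unfolding F_def[abs_def] using bound M by (intro Weierstrass_m_test) simp_all
  then have F: "continuous_on (sphere 0 1) F"
    by (rule uniform_limit_theorem[rotated]) (simp_all add: partial_sums_continuous)
  have coeff: "coeff_of F k j = coeff_of f k j" if j: "j \<in> {1..m k}" for k j
  proof -
    note bc = basis_continuous[OF j]
    have hb: "continuous_on (sphere 0 1) (\<lambda>x. harmonic_sum (coeff_of f) n x * B k j x)" for n
      by (intro continuous_intros harmonic_sum_continuous bc)
    have "coeff_of F k j = (LINT x|\<nu>. (\<Sum>n. harmonic_sum (coeff_of f) n x * B k j x))"
      unfolding L2_inner_def[of \<nu> F] F_def
      by (rule Bochner_Integration.integral_cong)
         (auto simp: space_sphere intro!: suminf_mult2 summ)
    also have "\<dots> = (\<Sum>n. (LINT x|\<nu>. harmonic_sum (coeff_of f) n x * B k j x))"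
    proof (rule integral_suminf)
      show "AE x in \<nu>. summable (\<lambda>n. norm (harmonic_sum (coeff_of f) n x * B k j x))"
      proof (rule AE_I2)
        fix x assume "x \<in> space \<nu>"
        then have "\<bar>harmonic_sum (coeff_of f) n x * B k j x\<bar> \<le> M n * \<bar>B k j x\<bar>" for n
          using bound[of x n] by (simp add: abs_mult space_sphere mult_right_mono)
        then show "summable (\<lambda>n. norm (harmonic_sum (coeff_of f) n x * B k j x))"
          by (intro summable_comparison_test'[OF summable_mult2[OF M, of "\<bar>B k j x\<bar>"], of 0]) simp
      qed
      have "(LINT x|\<nu>. norm (harmonic_sum (coeff_of f) n x * B k j x)) \<le> M n * (LINT x|\<nu>. \<bar>B k j x\<bar>)" for n
      proof -
        have "(LINT x|\<nu>. norm (harmonic_sum (coeff_of f) n x * B k j x)) \<le> (LINT x|\<nu>. M n * \<bar>B k j x\<bar>)"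
        proof (rule integral_mono)
          show "norm (harmonic_sum (coeff_of f) n x * B k j x) \<le> M n * \<bar>B k j x\<bar>" if "x \<in> space \<nu>" for x
            using bound[of x n] that by (simp add: abs_mult space_sphere mult_right_mono)
        qed (intro integrable_continuous continuous_intros hb bc)+
        then show ?thesis by simp
      qed
      then show "summable (\<lambda>n. (LINT x|\<nu>. norm (harmonic_sum (coeff_of f) n x * B k j x)))"
        by (intro summable_comparison_test'[OF summable_mult2[OF M], of 0]) simp
    qed (intro integrable_continuous hb)
    also have "\<dots> = (\<Sum>n. if n = k then coeff_of f k j else 0)"
      using harmonic_sum_inner[OF j, of "coeff_of f"]
      by (simp add: L2_inner_def[of \<nu> "harmonic_sum _ _"])
    also have "\<dots> = coeff_of f k j"
      using sums_single[of k "\<lambda>_. coeff_of f k j"] by (simp add: sums_iff)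
    finally show ?thesis .
  qed
  have "f x - F x = 0"
  proof (rule polynomials_separate[OF _ _ x])
    fix n and p :: "real ^ 'n \<Rightarrow> real" assume "p \<in> sphere_polys n"
    then obtain c where p: "p = (\<lambda>x. \<Sum>k\<le>n. harmonic_sum c k x)" using sphere_polys_expansion by blast
    have "L2_inner \<nu> (\<lambda>x. f x - F x) (B k j) = 0" if "j \<in> {1..m k}" for k j
      using L2_inner_diff_left[OF f F basis_continuous[OF that]] coeff[OF that] by simp
    then show "L2_inner \<nu> (\<lambda>x. f x - F x) p = 0"
      unfolding p by (subst inner_partial_sums) (auto intro!: continuous_intros f F)
  qed (intro continuous_intros f F)
  then show ?thesis using summ[OF x] by (simp add: F_def summable_sums)
qed

section \<open>Splines on the Fourier side\<close>

lemma spline_energy_summable: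
  assumes Y: "finite Y" "Y \<subseteq> sphere 0 1" and a: "\<And>n. a n > 0"
    and ma: "summable (\<lambda>n. real (m n) * a n)"
  shows "summable (\<lambda>n. energy (\<lambda>n j. a n * (\<Sum>y\<in>Y. \<alpha> y * B n j y)) n / a n)"
proof -
  \<comment> \<open>Cauchy-Schwarz over Y gives the sum of the squared \<alpha>; the factor
    \<open>card Y\<close> arises because the squared basis functions of degree n add up to
    \<open>m n\<close> at each point of Y.\<close>
  define K where "K = (\<Sum>y\<in>Y. (\<alpha> y)\<^sup>2) * real (card Y)"
  have "energy (\<lambda>n j. a n * (\<Sum>y\<in>Y. \<alpha> y * B n j y)) n / a n \<le> K * (real (m n) * a n)" for n
  proof -
    have "energy (\<lambda>n j. a n * (\<Sum>y\<in>Y. \<alpha> y * B n j y)) n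
        = (a n)\<^sup>2 * (\<Sum>j=1..m n. (\<Sum>y\<in>Y. \<alpha> y * B n j y)\<^sup>2)"
      by (simp only: energy_def power_mult_distrib sum_distrib_left[of "(a n)\<^sup>2"])
    also have "(\<Sum>j=1..m n. (\<Sum>y\<in>Y. \<alpha> y * B n j y)\<^sup>2) \<le>
        (\<Sum>j=1..m n. (\<Sum>y\<in>Y. (\<alpha> y)\<^sup>2) * (\<Sum>y\<in>Y. (B n j y)\<^sup>2))"
      by (intro sum_mono Cauchy_Schwarz_ineq_sum)
    also have "\<dots> = (\<Sum>y\<in>Y. (\<alpha> y)\<^sup>2) * (\<Sum>y\<in>Y. \<Sum>j=1..m n. (B n j y)\<^sup>2)"
      by (simp only: sum_distrib_left[symmetric] sum.swap[of _ Y])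
    also have "(\<Sum>y\<in>Y. \<Sum>j=1..m n. (B n j y)\<^sup>2) = (\<Sum>y\<in>Y. real (m n))"
      using Y(2) by (intro sum.cong basis_square_sum) auto
    finally have "energy (\<lambda>n j. a n * (\<Sum>y\<in>Y. \<alpha> y * B n j y)) n \<le> (a n)\<^sup>2 * (K * real (m n))"
      by (simp add: K_def mult_left_mono mult.assoc)
    then show ?thesis using a[of n] by (simp add: divide_le_eq power2_eq_square mult_ac)
  qed
  then show ?thesis
    by (intro summable_comparison_test'[OF summable_mult[OF ma, of K], of 0])
       (simp add: less_imp_le[OF a])
qed

lemma spline_expansion:
  assumes Y: "finite Y" "Y \<subseteq> sphere 0 1" and x: "x \<in> sphere 0 1"
    and phi: "\<And>u v :: real ^ 'n. \<lbrakk>u \<in> sphere 0 1; v \<in> sphere 0 1\<rbrakk> \<Longrightarrow>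
      (\<lambda>n. a n * poly (C n) (u \<bullet> v)) sums \<phi> (geodist u v)"
  shows "(\<lambda>n. harmonic_sum (\<lambda>n j. a n * (\<Sum>y\<in>Y. \<alpha> y * B n j y)) n x) sums
    (\<Sum>y\<in>Y. \<alpha> y * \<phi> (geodist x y))"
proof -
  have "(\<lambda>n. \<Sum>y\<in>Y. \<alpha> y * (a n * poly (C n) (x \<bullet> y))) sums (\<Sum>y\<in>Y. \<alpha> y * \<phi> (geodist x y))"
    using Y(2) by (intro sums_sum sums_mult phi x) auto
  moreover have "(\<Sum>y\<in>Y. \<alpha> y * (a n * poly (C n) (x \<bullet> y))) =
      harmonic_sum (\<lambda>n j. a n * (\<Sum>y\<in>Y. \<alpha> y * B n j y)) n x" for n
  proof -
    have "(\<Sum>y\<in>Y. \<alpha> y * (a n * poly (C n) (x \<bullet> y))) =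
        (\<Sum>y\<in>Y. \<alpha> y * (a n * (\<Sum>j=1..m n. B n j x * B n j y)))"
      using Y(2) x by (intro sum.cong refl) (simp only: kernel subsetD)
    then show ?thesis
      by (simp add: harmonic_sum_def sum_distrib_left sum_distrib_right sum.swap[of _ Y] mult_ac)
  qed
  ultimately show ?thesis by simp
qed

text \<open>The native weight 1 / \<open>a n\<close> cancels the factor \<open>a n\<close> in the
  spline coefficients. What remains is a combination of point values on Y, all of which
  vanish.\<close>

lemma spline_orthogonal:
  assumes a: "\<And>n. a n > 0" and e: "\<And>y. y \<in> Y \<Longrightarrow> (\<lambda>n. harmonic_sum b n y) sums 0"
  shows "(\<lambda>n. (\<Sum>j=1..m n. b n j * (a n * (\<Sum>y\<in>Y. \<alpha> y * B n j y))) / a n) sums 0"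
proof -
  have "(\<Sum>j=1..m n. b n j * (a n * (\<Sum>y\<in>Y. \<alpha> y * B n j y))) / a n =
      (\<Sum>y\<in>Y. \<alpha> y * harmonic_sum b n y)" for n
  proof -
    have "(\<Sum>j=1..m n. b n j * (a n * (\<Sum>y\<in>Y. \<alpha> y * B n j y))) =
        a n * (\<Sum>y\<in>Y. \<alpha> y * harmonic_sum b n y)"
      by (simp add: harmonic_sum_def sum_distrib_left sum.swap[of _ Y] mult_ac)
    then show ?thesis unfolding \<open>_ = _\<close> using a[of n] by simp
  qed
  moreover have "(\<lambda>n. \<Sum>y\<in>Y. \<alpha> y * harmonic_sum b n y) sums (\<Sum>y\<in>Y. \<alpha> y * 0)"
    by (intro sums_sum sums_mult e)
  ultimately show ?thesis by simp
qed

text \<open>The low frequencies of a function vanishing on \<open>Y\<close> are opposite to its high frequencies there,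
  so the norming property of \<open>Y\<close> bounds them by the tail.\<close>

lemma vanishing_bounds:
  assumes Y: "finite Y" "Y \<subseteq> sphere 0 1" and "N > 0"
    and fill: "fill_distance Y \<le> ereal (1 / (2 * real N))"
    and a: "\<And>n. a n > 0" and ma: "summable (\<lambda>n. real (m n) * a n)"
    and b: "summable (\<lambda>n. energy b n / a n)"
    and e: "\<And>x. x \<in> sphere 0 1 \<Longrightarrow> (\<lambda>n. harmonic_sum b n x) sums e x"
    and zero: "\<And>y. y \<in> Y \<Longrightarrow> e y = 0" and x: "x \<in> sphere 0 1"
  defines "R \<equiv> sqrt (\<Sum>n. real (m (n + Suc N)) * a (n + Suc N)) *
    sqrt (\<Sum>n. energy b (n + Suc N) / a (n + Suc N))"
  shows "\<bar>\<Sum>n<Suc N. harmonic_sum b n x\<bar> \<le> 8 / 7 * R" and "\<bar>e x\<bar> \<le> 15 / 7 * R"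
proof -
  have high: "\<bar>e z - (\<Sum>n<Suc N. harmonic_sum b n z)\<bar> \<le> R" if z: "z \<in> sphere 0 1" for z
  proof -
    let ?g = "\<lambda>n. sqrt (energy b (n + Suc N)) * sqrt (real (m (n + Suc N)))"
    have g: "summable ?g"
      using weighted_bound(1)[OF a ma b] by (rule summable_ignore_initial_segment)
    have le: "\<bar>harmonic_sum b (n + Suc N) z\<bar> \<le> ?g n" for n by (rule harmonic_sum_bound[OF z])
    then have s: "summable (\<lambda>n. \<bar>harmonic_sum b (n + Suc N) z\<bar>)"
      by (intro summable_comparison_test'[OF g, of 0]) simp
    have "e z - (\<Sum>n<Suc N. harmonic_sum b n z) = (\<Sum>n. harmonic_sum b (n + Suc N) z)"
      by (rule sums_unique[OF sums_split_initial_segment[OF e[OF z]]])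
    also have "\<bar>\<dots>\<bar> \<le> (\<Sum>n. \<bar>harmonic_sum b (n + Suc N) z\<bar>)" by (rule summable_rabs[OF s])
    also have "\<dots> \<le> suminf ?g" using le s g by (rule suminf_le)
    also have "\<dots> \<le> R" unfolding R_def by (rule weighted_bound(2)[OF a ma b])
    finally show ?thesis .
  qed
  show low: "\<bar>\<Sum>n<Suc N. harmonic_sum b n x\<bar> \<le> 8 / 7 * R"
  proof (rule sphere_poly_norming[OF _ \<open>N > 0\<close> Y fill _ x])
    show "(\<lambda>x. \<Sum>n<Suc N. harmonic_sum b n x) \<in> sphere_polys N"
      by (intro sphere_polys_sum sphere_polys_mono[OF harmonic_sum_poly]) simp
    show "\<bar>\<Sum>n<Suc N. harmonic_sum b n y\<bar> \<le> R" if "y \<in> Y" for y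
      using high[of y] zero[OF that] Y(2) that by auto
  qed
  \<comment> \<open>Low frequencies and tail add up: 8/7 + 1 = 15/7.\<close>
  from low high[OF x] show "\<bar>e x\<bar> \<le> 15 / 7 * R" by linarith
qed

text \<open>The constant \<open>64 / 49\<close> is the square of the norming constant \<open>8 / 7\<close> for the low frequencies;
  \<open>1 / 2\<close> is the gain for the tail from dimensions being at least \<open>2\<close> unless they vanish.\<close>

lemma smoothed_energy_bound:
  assumes Y: "finite Y" "Y \<subseteq> sphere 0 1" and "N > 0"
    and fill: "fill_distance Y \<le> ereal (1 / (2 * real N))"
    and a: "\<And>n. a n > 0" and ma: "summable (\<lambda>n. real (m n) * a n)"
    and b: "summable (\<lambda>n. energy b n / a n)"
    and e: "\<And>x. x \<in> sphere 0 1 \<Longrightarrow> (\<lambda>n. harmonic_sum b n x) sums e x"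
    and zero: "\<And>y. y \<in> Y \<Longrightarrow> e y = 0"
    and dim: "CARD('n) \<ge> 2" and lam: "mono lam" "\<And>n. lam n \<ge> 0"
    and lma: "summable (\<lambda>n. real (m n) * (lam n)\<^sup>2 * a n)"
  shows "summable (\<lambda>n. (lam n)\<^sup>2 * energy b n)"
    and "(\<Sum>n. (lam n)\<^sup>2 * energy b n) \<le> (64 / 49 + 1 / 2) *
      (\<Sum>n. real (m (n + Suc N)) * (lam (n + Suc N))\<^sup>2 * a (n + Suc N)) *
      (\<Sum>n. energy b (n + Suc N) / a (n + Suc N))"
proof -
  define T where "T = (\<Sum>n. real (m (n + Suc N)) * a (n + Suc N))"
  define A where "A = (\<Sum>n. real (m (n + Suc N)) * (lam (n + Suc N))\<^sup>2 * a (n + Suc N))"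
  define H where "H = (\<Sum>n. energy b (n + Suc N) / a (n + Suc N))"
  have sT: "summable (\<lambda>n. real (m (n + Suc N)) * a (n + Suc N))"
    using ma by (rule summable_ignore_initial_segment)
  have sA: "summable (\<lambda>n. real (m (n + Suc N)) * (lam (n + Suc N))\<^sup>2 * a (n + Suc N))"
    using lma by (rule summable_ignore_initial_segment)
  have sH: "summable (\<lambda>n. energy b (n + Suc N) / a (n + Suc N))"
    using b by (rule summable_ignore_initial_segment)
  have nonneg: "T \<ge> 0" "H \<ge> 0"
    unfolding T_def H_def using a by (intro suminf_nonneg sT sH; simp add: less_imp_le)+
  \<comment> \<open>A single term of the series A is at most A, and its factor \<open>m k\<close> is
    at least 2 unless it is 0, in which case the energy of degree k vanishes too.\<close>
  have high: "(lam (n + Suc N))\<^sup>2 * energy b (n + Suc N) \<le>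
      A / 2 * (energy b (n + Suc N) / a (n + Suc N))" for n
  proof -
    define k where "k = n + Suc N"
    have "real (m k) * (lam k)\<^sup>2 * a k \<le> A"
      unfolding k_def A_def
      using sum_le_suminf[OF sA, of "{n}"] a by (simp add: less_imp_le)
    moreover have "2 * ((lam k)\<^sup>2 * a k) \<le> real (m k) * ((lam k)\<^sup>2 * a k)" if "m k \<noteq> 0"
    proof (rule mult_right_mono)
      have "m k \<ge> 2" using harmonic_dim_not_one[OF dim, of k] that by (simp add: k_def)
      then show "2 \<le> real (m k)" by simp
    qed (use a[of k] in simp)
    ultimately have le: "(lam k)\<^sup>2 * a k \<le> A / 2" if "m k \<noteq> 0" using that by (simp add: mult.assoc)
    have "(lam k)\<^sup>2 * a k * (energy b k / a k) \<le> A / 2 * (energy b k / a k)"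
    proof (cases "m k = 0")
      case True
      then show ?thesis by (simp add: energy_def)
    next
      case False
      show ?thesis by (intro mult_right_mono le False divide_nonneg_pos energy_nonneg a)
    qed
    then show ?thesis using a[of k] by (simp add: k_def)
  qed
  have s: "summable (\<lambda>n. (lam (n + Suc N))\<^sup>2 * energy b (n + Suc N))"
    using high by (intro summable_comparison_test'[OF summable_mult[OF sH, of "A / 2"], of 0]) simp
  then show summ: "summable (\<lambda>n. (lam n)\<^sup>2 * energy b n)"
    using summable_iff_shift[of "\<lambda>n. (lam n)\<^sup>2 * energy b n" "Suc N"] by blast
  have "(\<Sum>n. (lam (n + Suc N))\<^sup>2 * energy b (n + Suc N)) \<le> A / 2 * H"
    unfolding H_def suminf_mult[OF sH, symmetric]
    by (intro suminf_le high s summable_mult sH)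
  \<comment> \<open>Monotonicity replaces each symbol value by \<open>lam N\<close>. Parseval then
    turns the sum into an L2 norm, which the supremum bounds since the total mass is 1.\<close>
  moreover have "(\<Sum>n<Suc N. (lam n)\<^sup>2 * energy b n) \<le> 64 / 49 * A * H"
  proof -
    have "(\<Sum>n<Suc N. (lam n)\<^sup>2 * energy b n) \<le> (\<Sum>n<Suc N. (lam N)\<^sup>2 * energy b n)"
      using lam by (intro sum_mono mult_right_mono power_mono monoD[OF lam(1)]) auto
    also have "\<dots> = (lam N)\<^sup>2 * (LINT x|\<nu>. (\<Sum>n<Suc N. harmonic_sum b n x)\<^sup>2)"
      by (simp only: partial_sums_L2[OF finite_lessThan] energy_def sum_distrib_left)
    also have "(LINT x|\<nu>. (\<Sum>n<Suc N. harmonic_sum b n x)\<^sup>2) \<le> (LINT x|\<nu>. 64 / 49 * (T * H))"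
    proof (rule integral_mono)
      fix x assume "x \<in> space \<nu>"
      then have x: "x \<in> sphere 0 1" by (simp only: space_sphere)
      have "\<bar>\<Sum>n<Suc N. harmonic_sum b n x\<bar> \<le> 8 / 7 * (sqrt T * sqrt H)"
        unfolding T_def H_def
        by (rule vanishing_bounds(1)[OF Y \<open>N > 0\<close> fill a ma b e zero x])
      also have "\<dots> \<le> \<bar>8 / 7 * (sqrt T * sqrt H)\<bar>" by (rule abs_ge_self)
      finally have "(\<Sum>n<Suc N. harmonic_sum b n x)\<^sup>2 \<le> (8 / 7 * (sqrt T * sqrt H))\<^sup>2"
        by (rule abs_le_square_iff[THEN iffD1])
      then show "(\<Sum>n<Suc N. harmonic_sum b n x)\<^sup>2 \<le> 64 / 49 * (T * H)"
        using nonneg by (simp add: power_mult_distrib power_divide)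
    qed (intro integrable_continuous continuous_intros harmonic_sum_continuous)+
    also have "\<dots> = 64 / 49 * (T * H)" by (simp add: prob_space)
    also have "(lam N)\<^sup>2 * (64 / 49 * (T * H)) = 64 / 49 * ((lam N)\<^sup>2 * T) * H" by simp
    also have "\<dots> \<le> 64 / 49 * A * H"
    proof (intro mult_right_mono mult_left_mono)
      \<comment> \<open>All degrees in the tail exceed N, so \<open>lam N\<close> can be moved under
        the sum T termwise, giving at most A.\<close>
      have "(lam N)\<^sup>2 * (real (m (n + Suc N)) * a (n + Suc N)) \<le>
          real (m (n + Suc N)) * (lam (n + Suc N))\<^sup>2 * a (n + Suc N)" for n
      proof -
        have "(lam N)\<^sup>2 \<le> (lam (n + Suc N))\<^sup>2"
          using lam by (intro power_mono monoD[OF lam(1)]) auto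
        then have "(lam N)\<^sup>2 * (real (m (n + Suc N)) * a (n + Suc N)) \<le>
            (lam (n + Suc N))\<^sup>2 * (real (m (n + Suc N)) * a (n + Suc N))"
          using a by (intro mult_right_mono) (auto simp: less_imp_le)
        then show ?thesis by (simp only: mult_ac)
      qed
      then show "(lam N)\<^sup>2 * T \<le> A"
        unfolding T_def A_def suminf_mult[OF sT, symmetric]
        by (intro suminf_le summable_mult sT sA)
    qed (use nonneg in auto)
    finally show ?thesis by (simp add: mult_left_mono)
  qed
  moreover have "(\<Sum>n. (lam n)\<^sup>2 * energy b n) =
      (\<Sum>n. (lam (n + Suc N))\<^sup>2 * energy b (n + Suc N)) + (\<Sum>n<Suc N. (lam n)\<^sup>2 * energy b n)"
    using summ by (rule suminf_split_initial_segment)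
  ultimately show "(\<Sum>n. (lam n)\<^sup>2 * energy b n) \<le> (64 / 49 + 1 / 2) *
      (\<Sum>n. real (m (n + Suc N)) * (lam (n + Suc N))\<^sup>2 * a (n + Suc N)) *
      (\<Sum>n. energy b (n + Suc N) / a (n + Suc N))"
    unfolding A_def[symmetric] H_def[symmetric] by (simp add: algebra_simps)
qed

section \<open>Native and smooth energies as real series\<close>

lemma harm_proj_norm_energy:
  assumes "continuous_on (sphere 0 1) f"
  shows "(L2_nrm \<nu> (harm_proj \<nu> n f))\<^sup>2 = energy (coeff_of f) n"
  by (simp only: harm_proj_norm[OF assms] energy_def)

lemma native_energy_summable:
  assumes "\<And>n. a n > 0" "continuous_on (sphere 0 1) f" "native_energy \<nu> a f < \<infinity>"
  shows "summable (\<lambda>n. energy (coeff_of f) n / a n)"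
proof (rule summable_suminf_not_top)
  have "inverse (ennreal (a n)) * ennreal ((L2_nrm \<nu> (harm_proj \<nu> n f))\<^sup>2) =
      ennreal (energy (coeff_of f) n / a n)" for n
    using assms(1)[of n]
    by (simp add: harm_proj_norm_energy[OF assms(2)] inverse_ennreal ennreal_mult[symmetric]
        divide_inverse mult.commute)
  then show "(\<Sum>n. ennreal (energy (coeff_of f) n / a n)) \<noteq> top"
    using assms(3) by (simp add: native_energy_def less_top)
qed (simp add: assms(1) less_imp_le)

text \<open>Where \<open>lam n\<close> vanishes the \<open>ennreal\<close> weight is infinite, so
  finiteness forces the energy of that degree to be 0. The real convention
  \<open>inverse 0 = 0\<close> then gives the same zero term.\<close>

lemma smooth_energy_real:
  assumes a: "\<And>n. a n > 0" and lam: "\<And>n. lam n \<ge> 0" and f: "continuous_on (sphere 0 1) f"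
    and fin: "smooth_energy \<nu> lam a f < \<infinity>"
  shows "lam n = 0 \<Longrightarrow> energy (coeff_of f) n = 0"
    and "summable (\<lambda>n. energy (coeff_of f) n * (inverse (lam n * a n))\<^sup>2)"
    and "smooth_nrm \<nu> lam a f = sqrt (\<Sum>n. energy (coeff_of f) n * (inverse (lam n * a n))\<^sup>2)"
proof -
  define t where "t n = (inverse (ennreal (lam n * a n)))\<^sup>2 * ennreal (energy (coeff_of f) n)" for n
  have t: "smooth_energy \<nu> lam a f = suminf t"
    by (simp add: smooth_energy_def t_def[abs_def] harm_proj_norm_energy[OF f])
  have zero: "energy (coeff_of f) n = 0" if "lam n = 0" for n
  proof (rule ccontr)
    assume "energy (coeff_of f) n \<noteq> 0"
    then have "energy (coeff_of f) n > 0" by (simp add: less_le)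
    with that have "t n = \<infinity>" by (simp add: t_def ennreal_top_mult)
    moreover have "t n \<le> suminf t"
      using sum_le_suminf[of t "{n}"] by simp
    ultimately show False using fin t by simp
  qed
  then show "lam n = 0 \<Longrightarrow> energy (coeff_of f) n = 0" for n .
  have tn: "t n = ennreal (energy (coeff_of f) n * (inverse (lam n * a n))\<^sup>2)" for n
  proof (cases "lam n = 0")
    case True
    then show ?thesis by (simp add: t_def zero)
  next
    case False
    define q where "q = lam n * a n"
    have "q > 0" using False a[of n] lam[of n] by (simp add: q_def)
    then show ?thesis unfolding t_def q_def[symmetric]
      by (simp add: inverse_ennreal ennreal_power ennreal_mult[symmetric] mult.commute)
  qed
  have sum: "suminf t = (\<Sum>n. ennreal (energy (coeff_of f) n * (inverse (lam n * a n))\<^sup>2))"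
    by (intro arg_cong[where f = suminf] ext tn)
  show s: "summable (\<lambda>n. energy (coeff_of f) n * (inverse (lam n * a n))\<^sup>2)"
  proof (rule summable_suminf_not_top)
    show "(\<Sum>n. ennreal (energy (coeff_of f) n * (inverse (lam n * a n))\<^sup>2)) \<noteq> top"
      using fin unfolding t sum by (metis infinity_ennreal_def less_irrefl)
  qed simp
  have "suminf t = ennreal (\<Sum>n. energy (coeff_of f) n * (inverse (lam n * a n))\<^sup>2)"
    unfolding sum by (rule suminf_ennreal2[OF _ s]) simp
  then show "smooth_nrm \<nu> lam a f = sqrt (\<Sum>n. energy (coeff_of f) n * (inverse (lam n * a n))\<^sup>2)"
    using suminf_nonneg[OF s] by (simp add: smooth_nrm_def t del: inverse_mult_distrib)
qed

lemma energy_diff_le: "energy (\<lambda>n j. b n j - c n j) n \<le> 2 * energy b n + 2 * energy c n"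
proof -
  have "(u - v)\<^sup>2 \<le> 2 * u\<^sup>2 + 2 * v\<^sup>2" for u v :: real
    using zero_le_power2[of "u + v"] by (simp add: power2_eq_square algebra_simps)
  then show ?thesis
    unfolding energy_def sum_distrib_left sum.distrib[symmetric] by (rule sum_mono)
qed

text \<open>With H the squared native norm of the tail of the error, duality and the smoothing bound
  estimate H by a multiple of its own square root. Cancelling that root bounds the tail by the
  smooth norm of f.\<close>

lemma spline_error:
  assumes Y: "finite Y" "Y \<subseteq> sphere 0 1" and "N > 0"
    and fill: "fill_distance Y \<le> ereal (1 / (2 * real N))"
    and a: "\<And>n. a n > 0" and ma: "summable (\<lambda>n. real (m n) * a n)"
    and phi: "\<And>u v :: real ^ 'n. \<lbrakk>u \<in> sphere 0 1; v \<in> sphere 0 1\<rbrakk> \<Longrightarrow>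
      (\<lambda>n. a n * poly (C n) (u \<bullet> v)) sums \<phi> (geodist u v)"
    and dim: "CARD('n) \<ge> 2" and lam: "mono lam" "\<And>n. lam n \<ge> 0"
    and lma: "summable (\<lambda>n. real (m n) * (lam n)\<^sup>2 * a n)"
    and f: "f \<in> smooth_space \<nu> lam a" and S: "spline_interpolant \<phi> Y f S"
    and x: "x \<in> sphere 0 1"
  shows "\<bar>f x - S x\<bar> \<le> 3 *
    sqrt (\<Sum>n. real (m (n + Suc N)) * (lam (n + Suc N))\<^sup>2 * a (n + Suc N)) *
    sqrt (\<Sum>n. real (m (n + Suc N)) * a (n + Suc N)) * smooth_nrm \<nu> lam a f"
proof -
  have fc: "continuous_on (sphere 0 1) f" and nat: "native_energy \<nu> a f < \<infinity>"
    and smooth: "smooth_energy \<nu> lam a f < \<infinity>"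
    using f by (auto simp: smooth_space_def native_space_def)
  note sf = native_energy_summable[OF a fc nat]
  obtain \<alpha> where S: "\<And>x. x \<in> sphere 0 1 \<Longrightarrow> S x = (\<Sum>y\<in>Y. \<alpha> y * \<phi> (geodist x y))"
    and interp: "\<And>y. y \<in> Y \<Longrightarrow> S y = f y"
    using S unfolding spline_interpolant_def by blast
  define c where "c n j = a n * (\<Sum>y\<in>Y. \<alpha> y * B n j y)" for n j
  \<comment> \<open>The Fourier coefficients of the error f - S.\<close>
  define b where "b n j = coeff_of f n j - c n j" for n j
  have sc: "summable (\<lambda>n. energy c n / a n)"
    unfolding c_def[abs_def] by (rule spline_energy_summable[OF Y a ma])
  have sb: "summable (\<lambda>n. energy b n / a n)"
  proof (rule summable_comparison_test'[of _ 0])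
    show "summable (\<lambda>n. 2 * (energy (coeff_of f) n / a n) + 2 * (energy c n / a n))"
      by (intro summable_add summable_mult sf sc)
    show "norm (energy b n / a n) \<le> 2 * (energy (coeff_of f) n / a n) + 2 * (energy c n / a n)" for n
      using divide_right_mono[OF energy_diff_le[of "coeff_of f" c n] less_imp_le[OF a[of n]]] a[of n]
      by (simp add: b_def[abs_def] add_divide_distrib)
  qed
  have e: "(\<lambda>n. harmonic_sum b n z) sums (f z - S z)" if z: "z \<in> sphere 0 1" for z
  proof -
    have "(\<lambda>n. harmonic_sum c n z) sums S z"
      unfolding S[OF z] c_def[abs_def] by (rule spline_expansion[OF Y z phi])
    then have "(\<lambda>n. harmonic_sum (coeff_of f) n z - harmonic_sum c n z) sums (f z - S z)"
      using harmonic_expansion[OF a ma fc sf z] by (intro sums_diff)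
    then show ?thesis
      by (simp add: harmonic_sum_def b_def left_diff_distrib sum_subtractf)
  qed
  have zero: "f y - S y = 0" if "y \<in> Y" for y using interp[OF that] by simp
  define T where "T = (\<Sum>n. real (m (n + Suc N)) * a (n + Suc N))"
  define A where "A = (\<Sum>n. real (m (n + Suc N)) * (lam (n + Suc N))\<^sup>2 * a (n + Suc N))"
  define H where "H = (\<Sum>n. energy b (n + Suc N) / a (n + Suc N))"
  define W where "W = (\<Sum>n. energy (coeff_of f) n * (inverse (lam n * a n))\<^sup>2)"
  \<comment> \<open>The factor \<open>lam n\<close> is shifted onto the error: \<open>u\<close>
    measures its image under the pseudodifferential operator, \<open>w\<close> the smooth norm of
    f.\<close>
  define u where "u n = lam n * sqrt (energy b n)" for n
  define w where "w n = sqrt (energy (coeff_of f) n) * inverse (lam n * a n)" for n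
  have u2: "(u n)\<^sup>2 = (lam n)\<^sup>2 * energy b n"
    and w2: "(w n)\<^sup>2 = energy (coeff_of f) n * (inverse (lam n * a n))\<^sup>2" for n
    by (simp_all add: u_def w_def power_mult_distrib)
  have U1: "summable (\<lambda>n. (u n)\<^sup>2)"
    unfolding u2
    by (rule smoothed_energy_bound(1)[OF Y \<open>N > 0\<close> fill a ma sb e zero dim lam lma])
  have U2: "(\<Sum>n. (u n)\<^sup>2) \<le> (64 / 49 + 1 / 2) * A * H"
    unfolding u2 A_def H_def
    by (rule smoothed_energy_bound(2)[OF Y \<open>N > 0\<close> fill a ma sb e zero dim lam lma])
  note Ws = smooth_energy_real[OF a lam(2) fc smooth]
  have H0: "H \<ge> 0" and T0: "T \<ge> 0" and A0: "A \<ge> 0" and W0: "W \<ge> 0"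
    unfolding H_def T_def A_def W_def
    using summable_ignore_initial_segment[OF sb, of "Suc N"]
      summable_ignore_initial_segment[OF ma, of "Suc N"]
      summable_ignore_initial_segment[OF lma, of "Suc N"] Ws(2) a
    by (auto intro!: suminf_nonneg simp: less_imp_le simp del: add_Suc_right)
  define P where "P n = (\<Sum>j=1..m n. b n j * coeff_of f n j) / a n" for n
  have "(\<Sum>j=1..m n. b n j * coeff_of f n j) = energy b n + (\<Sum>j=1..m n. b n j * c n j)" for n
    unfolding energy_def sum.distrib[symmetric]
    by (rule sum.cong) (simp_all add: b_def power2_eq_square algebra_simps)
  then have P_eq: "P n = energy b n / a n + (\<Sum>j=1..m n. b n j * c n j) / a n" for n
    unfolding P_def by (simp only: add_divide_distrib)
  \<comment> \<open>As f is the error plus the spline, this orthogonality makes the terms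
    \<open>P n\<close> of the native inner product of error and f add up to the full squared native
    norm of the error.\<close>
  have orth: "(\<lambda>n. (\<Sum>j=1..m n. b n j * c n j) / a n) sums 0"
    unfolding c_def using e zero Y(2) by (intro spline_orthogonal[OF a]) force
  have P: "P sums (\<Sum>n. energy b n / a n)"
    using sums_add[OF summable_sums[OF sb] orth] by (simp only: P_eq[symmetric] add_0_right)
  have Pb: "\<bar>P n\<bar> \<le> \<bar>u n * w n\<bar>" for n
  proof -
    have "\<bar>P n\<bar> \<le> sqrt (energy b n) * sqrt (energy (coeff_of f) n) / a n"
      using divide_right_mono[OF inner_le_energy[of b n "coeff_of f"] less_imp_le[OF a[of n]]] a[of n]
      by (simp add: P_def)
    also have "\<dots> = \<bar>u n * w n\<bar>"
    proof (cases "lam n = 0")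
      \<comment> \<open>The factors \<open>lam n\<close> and \<open>inverse (lam n)\<close> do not
        cancel here, but f has no component of degree n.\<close>
      case True
      then show ?thesis using Ws(1) by (simp add: u_def)
    next
      case False
      then show ?thesis using a[of n] lam(2)[of n] by (simp add: u_def w_def abs_mult field_simps)
    qed
    finally show ?thesis .
  qed
  note uw = series_cauchy_schwarz[OF U1, of w, unfolded w2, OF Ws(2)]
  have "H \<le> (\<Sum>n. energy b n / a n)"
    unfolding H_def using suminf_split_initial_segment[OF sb, of "Suc N"] a
    by (simp add: sum_nonneg less_imp_le)
  also have "\<dots> = suminf P" using P by (rule sums_unique)
  also have "\<dots> \<le> (\<Sum>n. \<bar>u n * w n\<bar>)"
    using Pb P uw(1) by (intro suminf_le) (auto intro: order_trans[OF abs_ge_self] sums_summable)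
  also have "\<dots> \<le> sqrt (\<Sum>n. (u n)\<^sup>2) * sqrt W"
    using uw(2) by (simp add: W_def)
  also have "\<dots> \<le> sqrt ((64 / 49 + 1 / 2) * A * H) * sqrt W"
    using U2 W0 by (intro mult_right_mono real_sqrt_le_mono) auto
  also have "\<dots> \<le> 7 / 5 * sqrt A * sqrt H * sqrt W"
  proof -
    \<comment> \<open>64/49 + 1/2 = 177/98 < 49/25. The value 7/5 is chosen so that 15/7 times it is
      3.\<close>
    have "sqrt (64 / 49 + 1 / 2) \<le> 7 / 5" by (rule real_le_lsqrt) (auto simp: power2_eq_square)
    then have "sqrt (64 / 49 + 1 / 2) * (sqrt A * sqrt H * sqrt W) \<le> 7 / 5 * (sqrt A * sqrt H * sqrt W)"
      using A0 H0 W0 by (intro mult_right_mono) auto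
    then show ?thesis by (simp only: real_sqrt_mult mult.assoc)
  qed
  finally have "sqrt H * sqrt H \<le> 7 / 5 * sqrt A * sqrt W * sqrt H"
    using H0 by (simp add: mult_ac)
  have sqrtH: "sqrt H \<le> 7 / 5 * sqrt A * sqrt W"
  proof (cases "H = 0")
    case False
    with H0 have "sqrt H > 0" by simp
    with \<open>sqrt H * sqrt H \<le> _\<close> show ?thesis by (rule mult_right_le_imp_le)
  qed (use A0 W0 in simp)
  have "\<bar>f x - S x\<bar> \<le> 15 / 7 * (sqrt T * sqrt H)"
    unfolding T_def H_def by (rule vanishing_bounds(2)[OF Y \<open>N > 0\<close> fill a ma sb e zero x])
  also have "\<dots> \<le> 15 / 7 * (sqrt T * (7 / 5 * sqrt A * sqrt W))"
    using sqrtH T0 by (intro mult_left_mono) auto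
  also have "\<dots> = 3 * sqrt A * sqrt T * smooth_nrm \<nu> lam a f"
    by (simp add: Ws(3) W_def)
  finally show ?thesis by (simp only: A_def T_def)
qed

end

theorem theorem2p7:
  fixes d N :: nat
    and \<nu> :: "(real ^ 'n) measure"
    and B :: "nat \<Rightarrow> nat \<Rightarrow> real ^ 'n \<Rightarrow> real"
    and C :: "nat \<Rightarrow> real poly"
    and a :: "nat \<Rightarrow> real"
    and \<phi> :: "real \<Rightarrow> real"
    and s E :: real
    and Y :: "(real ^ 'n) set"
    and f S :: "real ^ 'n \<Rightarrow> real"
    and x :: "real ^ 'n"
  assumes "d \<ge> 1" and "CARD('n) = d + 1"
    and "normalised_invariant_measure \<nu>"
    and "\<And>n. orthonormal_basis_of \<nu> (harmonics \<nu> n) (harm_dim \<nu> n) (B n)"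
    and "\<And>n. normalised_gegenbauer d n (harm_dim \<nu> n) (B n) (C n)"
    and "\<And>n. a n > 0"
    and "summable (\<lambda>n. real (harm_dim \<nu> n) * a n)"
    and "\<And>(u :: real ^ 'n) (v :: real ^ 'n). \<lbrakk>u \<in> sphere 0 1; v \<in> sphere 0 1\<rbrakk> \<Longrightarrow>
           (\<lambda>n. a n * poly (C n) (u \<bullet> v)) sums \<phi> (geodist u v)"
    and "N > 0"
    and "finite Y" and "Y \<subseteq> sphere 0 1"
    and "fill_distance Y \<le> ereal (1 / (2 * real N))"
    and "s > 0"
    and "summable (\<lambda>n. real (harm_dim \<nu> n) * (symbol d s n)\<^sup>2 * a n)"
    and "\<And>n p. p \<in> sphere_polys n \<Longrightarrow>
           Linf_nrm \<nu> (pseudodiff \<nu> (symbol d s) p) \<le> ereal (E * symbol d s n) * Linf_nrm \<nu> p"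
    and "f \<in> smooth_space \<nu> (symbol d s) a"
    and "spline_interpolant \<phi> Y f S"
    and "x \<in> sphere 0 1"
  shows "\<bar>f x - S x\<bar> \<le> (1 + 2 * E)
           * sqrt (\<Sum>\<^sub>\<infinity>n\<in>{N<..}. real (harm_dim \<nu> n) * (symbol d s n)\<^sup>2 * a n)
           * sqrt (\<Sum>\<^sub>\<infinity>n\<in>{N<..}. real (harm_dim \<nu> n) * a n)
           * smooth_nrm \<nu> (symbol d s) a f"
proof -
  interpret zonal_basis \<nu> "harm_dim \<nu>" B C
    using assms(3-5) by unfold_locales (auto simp: normalised_gegenbauer_def)
  define A where "A = (\<Sum>n. real (harm_dim \<nu> (n + Suc N)) * (symbol d s (n + Suc N))\<^sup>2 * a (n + Suc N))"
  define T where "T = (\<Sum>n. real (harm_dim \<nu> (n + Suc N)) * a (n + Suc N))"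
  have dim: "CARD('n) \<ge> 2" using assms(1,2) by simp
  have bound: "\<bar>f x - S x\<bar> \<le> 3 * sqrt A * sqrt T * smooth_nrm \<nu> (symbol d s) a f"
    unfolding A_def T_def
    by (rule spline_error[OF assms(10,11,9,12,6,7,8) dim mono_symbol[OF assms(1,13)]
          symbol_nonneg assms(14,16,17,18)])
  have A: "(\<Sum>\<^sub>\<infinity>n\<in>{N<..}. real (harm_dim \<nu> n) * (symbol d s n)\<^sup>2 * a n) = A"
    unfolding A_def using assms(6,14)
    by (intro infsum_greaterThan_eq_suminf) (simp_all add: less_imp_le)
  have T: "(\<Sum>\<^sub>\<infinity>n\<in>{N<..}. real (harm_dim \<nu> n) * a n) = T"
    unfolding T_def using assms(6,7)
    by (intro infsum_greaterThan_eq_suminf) (simp_all add: less_imp_le)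
  show ?thesis unfolding A T
  proof (cases "\<exists>n>N. harm_dim \<nu> n \<noteq> 0")
    case True
    \<comment> \<open>Since N is positive, n \<ge> 2, so the symbol is positive even on the circle
      and a basis harmonic of degree n gives E \<ge> 1.\<close>
    then obtain n where n: "n > N" "harm_dim \<nu> n \<noteq> 0" by blast
    with \<open>N > 0\<close> have "symbol d s n > 0" by (intro symbol_pos assms(1)) simp
    then have E: "E \<ge> 1" using n(2) assms(15) by (intro bernstein_constant_ge_1)
    have "A \<ge> 0" "T \<ge> 0"
      unfolding A[symmetric] T[symmetric]
      using assms(6) by (auto intro!: infsum_nonneg simp: less_imp_le)
    then have "3 * sqrt A * sqrt T * smooth_nrm \<nu> (symbol d s) a f \<le>
        (1 + 2 * E) * sqrt A * sqrt T * smooth_nrm \<nu> (symbol d s) a f"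
      using E by (intro mult_right_mono) (auto simp: smooth_nrm_def)
    with bound show "\<bar>f x - S x\<bar> \<le> (1 + 2 * E) * sqrt A * sqrt T * smooth_nrm \<nu> (symbol d s) a f"
      by linarith
  next
    case False
    \<comment> \<open>With no harmonics above degree N the bound with constant 3 already makes the
      error zero, whatever the value of E.\<close>
    then have "T = 0" by (simp add: T_def)
    with bound show "\<bar>f x - S x\<bar> \<le> (1 + 2 * E) * sqrt A * sqrt T * smooth_nrm \<nu> (symbol d s) a f"
      by simp
  qed
qed

end
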